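(* Let $\Omega\colon\mathbb{R}\to\mathbb{R}_+$ be a continual diagram and let $\epsilon>0$ and $z_0\in\mathbb{R}$ be fixed. Assume that $z_-^{\min}$ is the minimal solution of the equation \[\Omega(z_-^{\min}+\epsilon)-\Omega(z_0+\epsilon)=z_0-z_-^{\min}-2\epsilon.\] Then for every continual diagram $\omega$ with $d(\Omega,\omega)\le\epsilon$, \[K_\omega(z_0)\ \ge\ \int_{-\infty}^{z_-^{\min}+\epsilon}\left[1-\frac{\epsilon}{z_-^{\min}+2\epsilon-z}\right]d\mu_\Omega(z).\]
   Context: A continual diagram is a function $\omega\colon\mathbb{R}\to\mathbb{R}_+$ such that $|\omega(z_1)-\omega(z_2)|\le|z_1-z_2|$ for all $z_1,z_2$, and $\omega(z)=|z|$ for all sufficiently large $|z|$. Transition measure: $\log[z\,\mathbf{G}_\omega(z)]=-\int_{-\infty}^\infty\frac{1}{z-w}\big(\frac{\omega(w)-|w|}{2}\big)'\,dw$ for $z\in\mathbb{C}\setminus\mathbb{R}$, and $\mu_\omega$ is the unique probability measure with $\mathbf{G}_\omega(z)=\int\frac{d\mu_\omega(x)}{z-x}$; $K_\omega(z)=\mu_\omega((-\infty,z])$. Metric $d$: for $x,y\ge0$ write $(x,y)\in\omega$ if $\omega(x-y)=x+y$; $\Pi^\omega_Y(x)=\{y\ge0:(x,y)\in\omega\}$, $\Pi^\omega_X(y)=\{x\ge0:(x,y)\in\omega\}$; $d_Y(\omega_1,\omega_2)=\sup_{x\ge0}d_H(\Pi^{\omega_1}_Y(x),\Pi^{\omega_2}_Y(x))$,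 $d_X(\omega_1,\omega_2)=\sup_{y\ge0}d_H(\Pi^{\omega_1}_X(y),\Pi^{\omega_2}_X(y))$ ($d_H$ = Hausdorff distance), $d=\max(d_X,d_Y)$. *)

theory Defs
  imports "HOL-Analysis.Analysis" "HOL-Probability.Probability"
begin

definition continual_diagram :: "(real \<Rightarrow> real) \<Rightarrow> bool" where
  "continual_diagram \<omega> \<longleftrightarrow>
     (\<forall>z. 0 \<le> \<omega> z) \<and>
     (\<forall>z1 z2. \<bar>\<omega> z1 - \<omega> z2\<bar> \<le> \<bar>z1 - z2\<bar>) \<and>
     (\<exists>C. \<forall>z. C \<le> \<bar>z\<bar> \<longrightarrow> \<omega> z = \<bar>z\<bar>)"

definition cauchy_transform :: "real measure \<Rightarrow> complex \<Rightarrow> complex" where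
  "cauchy_transform \<mu> z = (\<integral>x. 1 / (z - complex_of_real x) \<partial>\<mu>)"

text \<open>Transition measure of a diagram: a Borel probability measure on the reals
  whose Cauchy transform satisfies z G(z) = exp(- int 1/(z-w) sigma'(w) dw) off the real
  line, where sigma(w) = (omega(w) - |w|)/2 and sigma' is (any Borel version of) its
  almost-everywhere derivative.\<close>
definition is_transition_measure :: "(real \<Rightarrow> real) \<Rightarrow> real measure \<Rightarrow> bool" where
  "is_transition_measure \<omega> \<mu> \<longleftrightarrow>
     prob_space \<mu> \<and> sets \<mu> = sets borel \<and>
     (\<forall>g. g \<in> borel_measurable lborel \<and>
          (AE w in lborel. ((\<lambda>w. (\<omega> w - \<bar>w\<bar>) / 2) has_real_derivative g w) (at w)) \<longrightarrow>
          (\<forall>z. Im z \<noteq> 0 \<longrightarrow>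
             z * cauchy_transform \<mu> z =
             exp (- (\<integral>w. complex_of_real (g w) / (z - complex_of_real w) \<partial>lborel))))"

definition K_fun :: "real measure \<Rightarrow> real \<Rightarrow> real" where
  "K_fun \<mu> z = measure \<mu> {..z}"

definition hausdorff_dist :: "real set \<Rightarrow> real set \<Rightarrow> real" where
  "hausdorff_dist A B = max (SUP a\<in>A. infdist a B) (SUP b\<in>B. infdist b A)"

definition in_diagram :: "real \<Rightarrow> real \<Rightarrow> (real \<Rightarrow> real) \<Rightarrow> bool" where
  "in_diagram x y \<omega> \<longleftrightarrow> 0 \<le> x \<and> 0 \<le> y \<and> \<omega> (x - y) = x + y"

definition PiY :: "(real \<Rightarrow> real) \<Rightarrow> real \<Rightarrow> real set" where
  "PiY \<omega> x = {y. 0 \<le> y \<and> in_diagram x y \<omega>}"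

definition PiX :: "(real \<Rightarrow> real) \<Rightarrow> real \<Rightarrow> real set" where
  "PiX \<omega> y = {x. 0 \<le> x \<and> in_diagram x y \<omega>}"

definition dY :: "(real \<Rightarrow> real) \<Rightarrow> (real \<Rightarrow> real) \<Rightarrow> real" where
  "dY \<omega>1 \<omega>2 = (SUP x\<in>{0..}. hausdorff_dist (PiY \<omega>1 x) (PiY \<omega>2 x))"

definition dX :: "(real \<Rightarrow> real) \<Rightarrow> (real \<Rightarrow> real) \<Rightarrow> real" where
  "dX \<omega>1 \<omega>2 = (SUP y\<in>{0..}. hausdorff_dist (PiX \<omega>1 y) (PiX \<omega>2 y))"

definition diagram_dist :: "(real \<Rightarrow> real) \<Rightarrow> (real \<Rightarrow> real) \<Rightarrow> real" where
  "diagram_dist \<omega>1 \<omega>2 = max (dX \<omega>1 \<omega>2) (dY \<omega>1 \<omega>2)"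

end

theory Submission
  imports Defs "HOL-Complex_Analysis.Complex_Analysis"
begin

text \<open>
  Write \<open>a = (1 + \<omega>') / 2\<close> and \<open>b(w) = (1 + \<Omega>'(w + \<epsilon>)) / 2\<close>, both with values in \<open>[0, 1]\<close>, and let \<open>\<nu>\<close> be
  \<open>\<mu>\<Omega>\<close> shifted by \<open>-\<epsilon>\<close>. For large \<open>M\<close> the Cauchy transforms of \<open>\<mu>\<omega>\<close> and \<open>\<nu>\<close> are
  \<open>exp (- \<integral> v(w) / (z - w) dw) / (z - M)\<close>, integrated over \<open>[-M, M]\<close>, with \<open>v = a\<close> and \<open>v = b\<close>. The distance
  bound says that the primitives of \<open>a\<close> and \<open>b\<close> are close, so there is \<open>zc\<close> between \<open>zmin\<close> and \<open>z0\<close> such that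
  \<open>u = b\<close> on \<open>(-\<infinity>, zc)\<close>, \<open>u = 0\<close> on \<open>[zc, z0]\<close>, \<open>u = a\<close> on \<open>(z0, \<infinity>)\<close> belongs to a diagram that passes
  through \<open>(z0, \<omega> z0)\<close> and lies above \<open>\<omega>\<close> on the left of \<open>z0\<close>.

  The transform \<open>H\<close> of \<open>u\<close> equals \<open>R\<close> times that of \<open>\<nu>\<close> and \<open>S\<close> times that of \<open>\<mu>\<omega>\<close>, where \<open>R\<close> is real and
  regular on \<open>(-\<infinity>, zc)\<close> and \<open>S\<close> on \<open>(z0, \<infinity>)\<close>. As \<open>- Im H / \<pi>\<close> is nonnegative in the upper half-plane and
  has total mass one on horizontal lines, Stieltjes inversion gives
  \<open>\<integral> R d\<nu> + \<integral> S d\<mu>\<omega> \<le> 1\<close>, the integrals being over \<open>(-\<infinity>, zc)\<close> and \<open>(z0, \<infinity>)\<close>; no measure with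
  transform \<open>H\<close> has to be constructed. The second mean value theorem yields \<open>S \<ge> 1\<close> and
  \<open>R(x) \<ge> (zc - x) / (zc + \<epsilon> - x)\<close>, which is the claim.
\<close>

section \<open>Almost everywhere differentiability\<close>

text \<open>Open intervals matter because they are the boxes on which Lebesgue measure is recognised
  in the next lemma; continuity makes the right end point a null set.\<close>

lemma emeasure_interval_measure_greaterThanLessThan:
  fixes F :: "real \<Rightarrow> real"
  assumes "mono F" "continuous_on UNIV F" "l \<le> u"
  shows "emeasure (interval_measure F) {l<..<u} = ennreal (F u - F l)"
proof (cases "l = u")
  case False
  have mono: "\<And>x y. x \<le> y \<Longrightarrow> F x \<le> F y" using \<open>mono F\<close> by (auto dest: monoD)
  have cont: "\<And>a b. continuous_on {a..b} F" using assms(2) continuous_on_subset by blast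
  have rc: "\<And>a. continuous (at_right a) F"
    using assms(2) by (simp add: continuous_on_eq_continuous_at continuous_at_imp_continuous_at_within)
  have "{u..u} \<in> null_sets (interval_measure F)"
    using emeasure_interval_measure_Icc[of u u F] mono cont assms(2) by (auto intro!: null_setsI)
  then have "emeasure (interval_measure F) ({l<..u} - {u..u}) = emeasure (interval_measure F) {l<..u}"
    by (intro emeasure_Diff_null_set) auto
  moreover have "{l<..u} - {u..u} = {l<..<u}" using False assms(3) by auto
  ultimately show ?thesis
    using emeasure_interval_measure_Ioc[of l u F] mono rc assms(3) by simp
qed auto

text \<open>The increments of \<open>F\<close> and of \<open>t - F t\<close> over an interval add up
  to its length. Hence the sum of the two Stieltjes measures, built explicitly as \<open>M\<close>,
  agrees with Lebesgue measure on boxes and therefore on all Borel sets.\<close>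

lemma emeasure_interval_measure_complement:
  fixes F :: "real \<Rightarrow> real"
  assumes F: "mono F" and G: "mono (\<lambda>t. t - F t)" and c: "continuous_on UNIV F"
    and A: "A \<in> sets borel"
  shows "emeasure lborel A = emeasure (interval_measure F) A + emeasure (interval_measure (\<lambda>t. t - F t)) A"
proof -
  let ?G = "\<lambda>t. t - F t"
  have cG: "continuous_on UNIV ?G" using c by (intro continuous_intros)
  define \<mu> where "\<mu> A = emeasure (interval_measure F) A + emeasure (interval_measure ?G) A" for A
  define M where "M = measure_of UNIV (sets borel) \<mu>"
  have "countably_additive (sets borel) \<mu>"
    unfolding countably_additive_def \<mu>_def
  proof (intro allI impI)
    fix A :: "nat \<Rightarrow> real set" assume *: "range A \<subseteq> sets borel" "disjoint_family A" "\<Union> (range A) \<in> sets borel"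
    show "(\<Sum>i. emeasure (interval_measure F) (A i) + emeasure (interval_measure ?G) (A i)) =
      emeasure (interval_measure F) (\<Union> (range A)) + emeasure (interval_measure ?G) (\<Union> (range A))"
      using * by (subst suminf_add[symmetric]) (auto simp: suminf_emeasure)
  qed
  moreover have "positive (sets borel) \<mu>" by (simp add: positive_def \<mu>_def)
  moreover have "sigma_algebra UNIV (sets (borel::real measure))"
    using sets.sigma_algebra_axioms[of "borel::real measure"] by simp
  ultimately have em: "emeasure M B = \<mu> B" if "B \<in> sets borel" for B
    unfolding M_def using that by (intro emeasure_measure_of_sigma) auto
  have "lborel = M"
  proof (rule lborel_eqI)
    show "sets M = sets borel" unfolding M_def
      by (metis sets.sets_measure_of_eq space_borel)
    fix l u :: real assume "\<And>b. b \<in> Basis \<Longrightarrow> l \<bullet> b \<le> u \<bullet> b"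
    then have lu: "l \<le> u" by simp
    have "emeasure M {l<..<u} = ennreal (F u - F l) + ennreal (?G u - ?G l)"
      using emeasure_interval_measure_greaterThanLessThan[OF F c lu]
        emeasure_interval_measure_greaterThanLessThan[OF G cG lu]
      by (simp add: em \<mu>_def)
    also have "\<dots> = ennreal (u - l)"
      using lu monoD[OF F lu] monoD[OF G lu] by (subst ennreal_plus[symmetric]) (auto simp: algebra_simps)
    finally show "emeasure M (box l u) = ennreal (\<Prod>b\<in>Basis. (u - l) \<bullet> b)" by simp
  qed
  then show ?thesis using em[OF A] by (simp add: \<mu>_def)
qed

text \<open>By Vitali's covering theorem, countably many disjoint balls inside \<open>U\<close> with
  large increments cover \<open>E\<close> up to a null set; summing over them compares
  \<open>p\<close> times the length with the Stieltjes measure. The balls need only contain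
  \<open>x\<close>, not be centred there, so that one-sided difference quotients fit.\<close>

lemma Vitali_increment_bound:
  fixes F :: "real \<Rightarrow> real"
  assumes F: "mono F" "continuous_on UNIV F" and p: "p \<ge> 0" and U: "open U" "E \<subseteq> U"
    and E: "\<And>x d. x \<in> E \<Longrightarrow> 0 < d \<Longrightarrow> \<exists>c r. 0 < r \<and> r < d \<and> x \<in> cball c r \<and> p * (2 * r) \<le> F (c + r) - F (c - r)"
  shows "ennreal p * outer_measure_of lebesgue E \<le> emeasure (interval_measure F) U"
proof -
  define K where "K = {(c, r). 0 < r \<and> cball c r \<subseteq> U \<and> p * (2 * r) \<le> F (c + r) - F (c - r)}"
  have "\<exists>i. i \<in> K \<and> x \<in> cball (fst i) (snd i) \<and> snd i < d" if "x \<in> E" "0 < d" for x d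
  proof -
    obtain e where e: "e > 0" "ball x e \<subseteq> U" using U \<open>x \<in> E\<close> open_contains_ball by blast
    \<comment> \<open>Since \<open>x\<close> may lie anywhere in the ball, its points are within
      \<open>2 * r\<close> of \<open>x\<close>; the bound \<open>e/2\<close> on the radius keeps it
      inside \<open>ball x e\<close>.\<close>
    obtain c r where cr: "0 < r" "r < min d (e/2)" "x \<in> cball c r" "p * (2 * r) \<le> F (c + r) - F (c - r)"
      using E[OF \<open>x \<in> E\<close>, of "min d (e/2)"] e \<open>0 < d\<close> by auto
    have "cball c r \<subseteq> ball x e" using cr by (auto simp: dist_real_def)
    then show ?thesis using cr e by (intro exI[of _ "(c, r)"]) (auto simp: K_def)
  qed
  note cover = this
  have "\<And>i. i \<in> K \<Longrightarrow> 0 < snd i" by (auto simp: K_def)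
  from Vitali_covering_theorem_cballs[OF this cover]
  obtain C where C: "countable C" "C \<subseteq> K"
     "pairwise (\<lambda>i j. disjnt (cball (fst i) (snd i)) (cball (fst j) (snd j))) C"
     "negligible (E - (\<Union>i \<in> C. cball (fst i) (snd i)))"
    by blast
  let ?B = "\<lambda>i. cball (fst i) (snd i) :: real set"
  have dis: "disjoint_family_on ?B C"
    using C(3) by (auto simp: pairwise_def disjoint_family_on_def disjnt_def)
  have N: "E - (\<Union>i \<in> C. ?B i) \<in> null_sets lebesgue"
    using C(4) by (simp add: negligible_iff_null_sets)
  have "outer_measure_of lebesgue E \<le> outer_measure_of lebesgue ((\<Union>i \<in> C. ?B i) \<union> (E - (\<Union>i \<in> C. ?B i)))"
    by (rule outer_measure_of_mono) auto
  also have "\<dots> = emeasure lebesgue ((\<Union>i \<in> C. ?B i) \<union> (E - (\<Union>i \<in> C. ?B i)))"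
    using N C(1) by (intro outer_measure_of_eq sets.Un sets.countable_UN' null_setsD2[OF N]) auto
  also have "\<dots> = emeasure lebesgue (\<Union>i \<in> C. ?B i)"
    using N C(1) by (intro emeasure_Un_null_set) (auto intro!: sets.countable_UN')
  also have "\<dots> = emeasure lborel (\<Union>i \<in> C. ?B i)"
    using C(1) sets.countable_UN'[of C ?B lborel] by (auto simp: image_subset_iff)
  also have "\<dots> = (\<integral>\<^sup>+i. emeasure lborel (?B i) \<partial>count_space C)"
    using C(1) dis by (intro emeasure_UN_countable) auto
  finally have "ennreal p * outer_measure_of lebesgue E \<le> ennreal p * (\<integral>\<^sup>+i. emeasure lborel (?B i) \<partial>count_space C)"
    by (intro mult_left_mono) auto
  also have "\<dots> = (\<integral>\<^sup>+i. ennreal p * emeasure lborel (?B i) \<partial>count_space C)"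
    by (rule nn_integral_cmult[symmetric]) auto
  also have "\<dots> \<le> (\<integral>\<^sup>+i. emeasure (interval_measure F) (?B i) \<partial>count_space C)"
  proof (rule nn_integral_mono)
    fix i assume "i \<in> space (count_space C)"
    then obtain c r where i: "i = (c, r)" "0 < r" "p * (2 * r) \<le> F (c + r) - F (c - r)"
      using C(2) by (auto simp: K_def)
    have "emeasure (interval_measure F) {c - r..c + r} = F (c + r) - F (c - r)"
      using F i by (intro emeasure_interval_measure_Icc) (auto dest: monoD intro: continuous_on_subset)
    then show "ennreal p * emeasure lborel (?B i) \<le> emeasure (interval_measure F) (?B i)"
      using i p by (auto simp: cball_eq_atLeastAtMost ennreal_mult[symmetric] intro!: ennreal_leI)
  qed
  also have "\<dots> = emeasure (interval_measure F) (\<Union>i \<in> C. ?B i)"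
    using C(1) dis by (intro emeasure_UN_countable[symmetric]) auto
  also have "\<dots> \<le> emeasure (interval_measure F) U"
  proof (intro emeasure_mono UN_least)
    show "?B i \<subseteq> U" if "i \<in> C" for i
      using subsetD[OF C(2) that] by (cases i) (simp add: K_def)
  qed (use U in auto)
  finally show ?thesis .
qed

text \<open>Comparing \<open>F\<close> with its complement \<open>t - F t\<close> replaces the usual two-step Vitali argument: on the
  exceptional set the increments of the two functions exceed \<open>p\<close> and \<open>1 - q\<close> times the length, but they
  add up to the length.\<close>
lemma negligible_oscillating_increments:
  fixes F :: "real \<Rightarrow> real"
  assumes F: "mono F" and G: "mono (\<lambda>t. t - F t)" and c: "continuous_on UNIV F"
    and pq: "0 \<le> p" "q \<le> 1" "q < p" and bE: "bounded E"
    and hi: "\<And>x d. x \<in> E \<Longrightarrow> 0 < d \<Longrightarrow> \<exists>c r. 0 < r \<and> r < d \<and> x \<in> cball c r \<and> p * (2 * r) \<le> F (c + r) - F (c - r)"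
    and lo: "\<And>x d. x \<in> E \<Longrightarrow> 0 < d \<Longrightarrow> \<exists>c r. 0 < r \<and> r < d \<and> x \<in> cball c r \<and> F (c + r) - F (c - r) \<le> q * (2 * r)"
  shows "negligible E"
proof -
  let ?G = "\<lambda>t. t - F t"
  have cG: "continuous_on UNIV ?G" using c by (intro continuous_intros)
  \<comment> \<open>\<open>E\<close> is not known to be measurable, so the measure computations use
    a measurable hull of the same outer measure; boundedness of \<open>E\<close> makes this measure
    finite.\<close>
  obtain S where S: "S \<in> sets lebesgue" "E \<subseteq> S" "outer_measure_of lebesgue E = emeasure lebesgue S"
    using outer_measure_of_attain[of E lebesgue] by auto
  obtain a b where ab: "E \<subseteq> {a..b}" using bounded_subset_cbox_symmetric[OF bE] by (metis box_real(2))
  have "outer_measure_of lebesgue E \<le> outer_measure_of lebesgue {a..b}"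
    by (rule outer_measure_of_mono) fact
  also have "\<dots> < \<infinity>" by (simp add: emeasure_lborel_Icc_eq)
  finally have fin: "emeasure lebesgue S < \<infinity>" using S by simp
  then have Sm: "S \<in> lmeasurable" using S by (auto intro!: fmeasurableI)
  define m where "m = measure lebesgue S"
  have m: "emeasure lebesgue S = ennreal m" "m \<ge> 0"
    using fin by (auto simp: m_def emeasure_eq_ennreal_measure)
  \<comment> \<open>In an open \<open>U\<close> exceeding \<open>S\<close> by less than
    \<open>e\<close>, the two Stieltjes measures are at least \<open>p * m\<close> and
    \<open>(1 - q) * m\<close>, while their sum is the Lebesgue measure of \<open>U\<close>. Letting
    \<open>e\<close> tend to 0 leaves \<open>(p - q) * m \<le> 0\<close>.\<close>
  have "p * m + (1 - q) * m \<le> m + e" if "e > 0" for e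
  proof -
    obtain U where U: "open U" "S \<subseteq> U" "U - S \<in> lmeasurable" "emeasure lebesgue (U - S) < ennreal e"
      using sets_lebesgue_outer_open[OF S(1) \<open>e > 0\<close>] by blast
    have 1: "ennreal p * ennreal m \<le> emeasure (interval_measure F) U"
      using Vitali_increment_bound[OF F c pq(1) U(1) subset_trans[OF S(2) U(2)] hi] S(3) m(1) by simp
    have 2: "ennreal (1 - q) * ennreal m \<le> emeasure (interval_measure ?G) U"
    proof -
      have "\<exists>c r. 0 < r \<and> r < d \<and> x \<in> cball c r \<and> (1 - q) * (2 * r) \<le> ?G (c + r) - ?G (c - r)"
        if "x \<in> E" "0 < d" for x d
        using lo[OF that] by (force simp: algebra_simps)
      from Vitali_increment_bound[OF G cG _ U(1) subset_trans[OF S(2) U(2)] this]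
      show ?thesis using pq(2) S(3) m(1) by simp
    qed
    have "ennreal (p * m + (1 - q) * m) = ennreal p * ennreal m + ennreal (1 - q) * ennreal m"
      using pq m by (simp add: ennreal_mult)
    also have "\<dots> \<le> emeasure (interval_measure F) U + emeasure (interval_measure ?G) U"
      using 1 2 by (rule add_mono)
    also have "\<dots> = emeasure lborel U"
      using emeasure_interval_measure_complement[OF F G c, of U] U by simp
    also have "\<dots> = emeasure lebesgue (S \<union> (U - S))"
      using U by (simp add: Un_absorb1 emeasure_completion)
    also have "\<dots> \<le> emeasure lebesgue S + emeasure lebesgue (U - S)"
      using U S by (intro emeasure_subadditive) auto
    also have "\<dots> \<le> ennreal m + ennreal e"
      using U(4) m by (intro add_mono) auto
    finally show ?thesis using m \<open>e > 0\<close> by (simp flip: ennreal_plus)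
  qed
  then have "p * m + (1 - q) * m \<le> m" by (rule field_le_epsilon)
  then have "(p - q) * m \<le> 0" by (simp add: algebra_simps)
  then have "m = 0" using pq m by (simp add: mult_le_0_iff)
  then have "S \<in> null_sets lebesgue" using S m by (simp add: null_setsI)
  then show ?thesis using S negligible_iff_null_sets negligible_subset by blast
qed

lemma mono_contraction_continuous_on:
  fixes F :: "real \<Rightarrow> real"
  assumes F: "mono F" and G: "mono (\<lambda>t. t - F t)"
  shows "continuous_on UNIV F"
proof -
  have "\<bar>F x - F y\<bar> \<le> \<bar>x - y\<bar>" for x y
    using monoD[OF F, of x y] monoD[OF G, of x y] monoD[OF F, of y x] monoD[OF G, of y x]
    by (cases "x \<le> y") auto
  then have "1-lipschitz_on UNIV F"
    by (intro lipschitz_onI) (auto simp: dist_real_def)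
  then show ?thesis
    by (rule lipschitz_on_continuous_on)
qed

text \<open>Where the difference quotients have no limit, they oscillate across some pair of
  rationals \<open>q < p\<close>. The set of such points is a countable union of the negligible
  bounded sets \<open>E (p, q, n)\<close>.\<close>

lemma AE_has_derivative_mono_contraction:
  fixes F :: "real \<Rightarrow> real"
  assumes F: "mono F" and G: "mono (\<lambda>t. t - F t)"
  shows "AE x in lborel. \<exists>D. (F has_real_derivative D) (at x)"
proof -
  have inc: "0 \<le> F y - F x" "F y - F x \<le> y - x" if "x \<le> y" for x y
    using monoD[OF F that] monoD[OF G that] by auto
  have c: "continuous_on UNIV F" by (rule mono_contraction_continuous_on[OF F G])
  define hi where "hi p x \<longleftrightarrow> (\<forall>d>0. \<exists>c r. 0 < r \<and> r < d \<and> x \<in> cball c r \<and> p * (2 * r) \<le> F (c + r) - F (c - r))" for p x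
  define lo where "lo q x \<longleftrightarrow> (\<forall>d>0. \<exists>c r. 0 < r \<and> r < d \<and> x \<in> cball c r \<and> F (c + r) - F (c - r) \<le> q * (2 * r))" for q x
  define E where "E = (\<lambda>(p, q, n). {x. \<bar>x\<bar> \<le> real n \<and> 0 \<le> p \<and> q \<le> 1 \<and> q < p \<and> hi p x \<and> lo q x})"
  define N where "N = (\<Union>i \<in> \<rat> \<times> \<rat> \<times> UNIV. E i)"
  have "negligible (E (p, q, n))" for p q n
  proof (cases "0 \<le> p \<and> q \<le> 1 \<and> q < p")
    case True
    have "bounded (E (p, q, n))"
      by (rule bounded_subset[of "{- real n..real n}"]) (auto simp: E_def)
    then show ?thesis
      using True by (intro negligible_oscillating_increments[OF F G c, of p q])
        (auto simp: E_def hi_def lo_def)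
  next
    case False
    then have "E (p, q, n) = {}" by (auto simp: E_def)
    then show ?thesis by simp
  qed
  then have "negligible N"
    unfolding N_def by (intro negligible_countable_Union) (auto simp: countable_rat)
  then have "AE x in lebesgue. x \<notin> N"
    by (simp add: negligible_iff_null_sets AE_not_in)
  moreover have "\<exists>D. (F has_real_derivative D) (at x)" if "x \<notin> N" for x
  proof -
    define Q where "Q h = (F (x + h) - F x) / h" for h
    have Q: "0 \<le> Q h" "Q h \<le> 1" if "h \<noteq> 0" for h
      using that inc[of x "x + h"] inc[of "x + h" x] by (cases "h > 0"; simp add: Q_def field_simps)+
    \<comment> \<open>The interval between \<open>x\<close> and \<open>x + h\<close> is written as
      the ball with centre \<open>x + h / 2\<close> and radius \<open>\<bar>h\<bar> / 2\<close>, for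
      either sign of \<open>h\<close>.\<close>
    have QI: "F (x + h / 2 + \<bar>h\<bar> / 2) - F (x + h / 2 - \<bar>h\<bar> / 2) = Q h * \<bar>h\<bar>" if "h \<noteq> 0" for h
    proof (cases "h > 0")
      case True
      then have "x + h / 2 + \<bar>h\<bar> / 2 = x + h" "x + h / 2 - \<bar>h\<bar> / 2 = x" by auto
      then show ?thesis using True by (simp add: Q_def add.commute)
    next
      case False
      then have "x + h / 2 + \<bar>h\<bar> / 2 = x" "x + h / 2 - \<bar>h\<bar> / 2 = x + h" by auto
      then show ?thesis using False that by (simp add: Q_def add.commute)
    qed
    \<comment> \<open>\<open>A\<close> collects the eventual lower bounds of the difference
      quotient, so \<open>Sup A\<close> is its lower limit. It remains to see that the upper limit
      is no larger.\<close>
    define A where "A = {q. \<forall>\<^sub>F h in at 0. q \<le> Q h}"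
    have A0: "0 \<in> A" using Q by (auto simp: A_def eventually_at_filter)
    have A1: "q \<le> 1" if "q \<in> A" for q
    proof -
      have "\<forall>\<^sub>F h in at 0. q \<le> Q h \<and> h \<noteq> 0"
        using that by (auto simp: A_def eventually_at_filter)
      then obtain h where "q \<le> Q h" "h \<noteq> 0" using eventually_happens'[OF at_neq_bot] by blast
      then show ?thesis using Q[of h] by auto
    qed
    have bdd: "bdd_above A" using A1 by (auto simp: bdd_above_def)
    have "(Q \<longlongrightarrow> Sup A) (at 0)"
    proof (rule order_tendstoI)
      fix a assume "a < Sup A"
      then obtain q where "q \<in> A" "a < q" using A0 bdd less_cSup_iff by (metis empty_iff)
      then show "\<forall>\<^sub>F h in at 0. a < Q h" by (auto simp: A_def elim: eventually_mono)
    next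
      fix a assume "Sup A < a"
      \<comment> \<open>Two rationals \<open>q < p\<close> are placed between \<open>Sup A\<close>
        and \<open>a\<close>: quotients fall below \<open>q\<close> arbitrarily close to 0 because
        \<open>q\<close> exceeds the lower limit, and if they were not eventually below
        \<open>p\<close>, then \<open>x\<close> would belong to \<open>N\<close>.\<close>
      then obtain p where p: "p \<in> \<rat>" "Sup A < p" "p < a" using Rats_dense_in_real by blast
      then obtain q where q: "q \<in> \<rat>" "Sup A < q" "q < p" using Rats_dense_in_real by blast
      have "0 \<le> Sup A" using A0 bdd by (rule cSup_upper)
      have "q \<notin> A" using q bdd cSup_upper by fastforce
      then have fq: "\<exists>\<^sub>F h in at 0. Q h < q"
        by (simp add: A_def frequently_def not_less)
      have "\<forall>\<^sub>F h in at 0. Q h < p"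
      proof (rule ccontr)
        assume "\<not> ?thesis"
        then have fp: "\<exists>\<^sub>F h in at 0. p \<le> Q h" by (simp add: frequently_def not_le)
        have ex: "\<exists>h. h \<noteq> 0 \<and> \<bar>h\<bar> < d \<and> P (Q h)" if "\<exists>\<^sub>F h in at 0. P (Q h)" "0 < d" for P d
          using that unfolding frequently_at by (auto simp: dist_real_def)
        have cb: "x \<in> cball (x + h / 2) (\<bar>h\<bar> / 2)" for h
          by (auto simp: dist_real_def)
        have "hi p x" unfolding hi_def
        proof (intro allI impI)
          fix d :: real assume "0 < d"
          then obtain h where h: "h \<noteq> 0" "\<bar>h\<bar> < d" "p \<le> Q h" using ex[OF fp] by blast
          then show "\<exists>c r. 0 < r \<and> r < d \<and> x \<in> cball c r \<and> p * (2 * r) \<le> F (c + r) - F (c - r)"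
            using QI[of h] cb[of h] by (intro exI[of _ "x + h / 2"] exI[of _ "\<bar>h\<bar> / 2"]) (auto intro: mult_right_mono)
        qed
        moreover have "lo q x" unfolding lo_def
        proof (intro allI impI)
          fix d :: real assume "0 < d"
          then obtain h where h: "h \<noteq> 0" "\<bar>h\<bar> < d" "Q h < q" using ex[OF fq] by blast
          then show "\<exists>c r. 0 < r \<and> r < d \<and> x \<in> cball c r \<and> F (c + r) - F (c - r) \<le> q * (2 * r)"
            using QI[of h] cb[of h] by (intro exI[of _ "x + h / 2"] exI[of _ "\<bar>h\<bar> / 2"]) (auto intro: mult_right_mono)
        qed
        moreover have "q \<le> 1" "0 \<le> p"
        proof -
          obtain h where "h \<noteq> 0" "p \<le> Q h" using ex[OF fp, of 1] by auto
          then show "q \<le> 1" using Q[of h] q by auto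
          show "0 \<le> p" using p \<open>0 \<le> Sup A\<close> by auto
        qed
        moreover obtain n where "\<bar>x\<bar> \<le> real n" using real_arch_simple by blast
        ultimately have "x \<in> E (p, q, n)" using q by (auto simp: E_def)
        then show False using p q that by (auto simp: N_def)
      qed
      then show "\<forall>\<^sub>F h in at 0. Q h < a" using p by (auto elim: eventually_mono)
    qed
    then show ?thesis unfolding DERIV_def Q_def by (rule exI)
  qed
  ultimately have "AE x in lebesgue. \<exists>D. (F has_real_derivative D) (at x)"
    by (auto elim: eventually_mono)
  then show ?thesis by (simp add: AE_completion_iff)
qed

text \<open>The difference quotients with step \<open>1 / Suc n\<close> lie in \<open>[0, 1]\<close>
  and converge almost everywhere to the derivative. Dominated convergence then gives the fundamental
  theorem, because the integrals of the quotients are explicit in terms of an antiderivative of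
  \<open>F\<close>.\<close>

lemma mono_contraction_density:
  fixes F :: "real \<Rightarrow> real"
  assumes F: "mono F" and G: "mono (\<lambda>t. t - F t)"
  obtains v :: "real \<Rightarrow> real" where "v \<in> borel_measurable borel" "\<And>x. 0 \<le> v x" "\<And>x. v x \<le> 1"
    "AE x in lborel. (F has_real_derivative v x) (at x)"
    "\<And>a b. a \<le> b \<Longrightarrow> (v has_integral (F b - F a)) {a..b}"
proof -
  have inc: "0 \<le> F y - F x" "F y - F x \<le> y - x" if "x \<le> y" for x y
    using monoD[OF F that] monoD[OF G that] by auto
  have c: "continuous_on UNIV F" by (rule mono_contraction_continuous_on[OF F G])
  have Fm [measurable]: "F \<in> borel_measurable borel" using c by (rule borel_measurable_continuous_onI)
  define Q where "Q n x = (F (x + 1 / Suc n) - F x) / (1 / Suc n)" for n x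
  have Qm [measurable]: "Q n \<in> borel_measurable borel" for n unfolding Q_def by measurable
  have Q: "0 \<le> Q n x" "Q n x \<le> 1" for n x
    using inc[of x "x + 1 / Suc n"] by (auto simp: Q_def pos_divide_le_eq pos_le_divide_eq simp del: of_nat_Suc intro!: divide_nonneg_pos)
  \<comment> \<open>Clamping makes the bounds 0 and 1 hold at every point, including those where the
    limit does not exist, and keeps \<open>v\<close> Borel.\<close>
  define v where "v x = max 0 (min 1 (lim (\<lambda>n. Q n x)))" for x
  have vm [measurable]: "v \<in> borel_measurable borel" unfolding v_def by measurable
  have v01: "0 \<le> v x" "v x \<le> 1" for x by (auto simp: v_def)
  have h0: "(\<lambda>n. 1 / real (Suc n)) \<longlonglongrightarrow> 0" by (rule LIMSEQ_Suc, rule lim_const_over_n)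
  then have h: "filterlim (\<lambda>n. 1 / real (Suc n)) (at 0) sequentially"
    by (auto simp: filterlim_at)
  have D: "Q' \<longlonglongrightarrow> D" if "(f has_real_derivative D) (at x)" "Q' = (\<lambda>n. (f (x + 1 / Suc n) - f x) / (1 / Suc n))"
    for f D x and Q' :: "nat \<Rightarrow> real"
  proof -
    have "((\<lambda>h. (f (x + h) - f x) / h) \<longlongrightarrow> D) (at 0)" using that by (simp add: DERIV_def)
    from filterlim_compose[OF this h] show ?thesis by (simp add: that)
  qed
  have AEv: "AE x in lborel. (F has_real_derivative v x) (at x) \<and> (\<lambda>n. Q n x) \<longlonglongrightarrow> v x"
    using AE_has_derivative_mono_contraction[OF F G]
  proof eventually_elim
    case (elim x)
    then obtain d where d: "(F has_real_derivative d) (at x)" by auto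
    have l: "(\<lambda>n. Q n x) \<longlonglongrightarrow> d" using D[OF d] by (simp add: Q_def)
    then have "0 \<le> d" "d \<le> 1" using Q by (auto intro: LIMSEQ_le_const LIMSEQ_le_const2)
    then have "v x = d" using limI[OF l] by (simp add: v_def)
    then show ?case using d l by simp
  qed
  \<comment> \<open>With \<open>\<Phi>' = F\<close>, integrating \<open>Q n\<close> over
    \<open>[a, b]\<close> yields the difference quotient of \<open>\<Phi>\<close> at
    \<open>b\<close> minus the one at \<open>a\<close>, which tends to
    \<open>F b - F a\<close>.\<close>
  obtain \<Phi> where \<Phi>: "\<And>x. (\<Phi> has_vector_derivative F x) (at x)"
    using einterval_antiderivative[of "-\<infinity>" \<infinity> F] c by (auto simp: continuous_on_eq_continuous_at)
  have \<Phi>': "(\<Phi> has_real_derivative F x) (at x)" for x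
    using \<Phi>[of x] by (simp add: has_real_derivative_iff_has_vector_derivative)
  have vint: "(v has_integral (F b - F a)) {a..b}" if "a \<le> b" for a b
  proof -
    have si: "set_integrable lborel {a..b} v" unfolding set_integrable_def
      by (rule integrableI_bounded_set_indicator[where B = 1]) (use v01 in \<open>auto simp: emeasure_lborel_Icc_eq\<close>)
    have "(\<lambda>n. LINT x|lborel. indicator {a..b} x *\<^sub>R Q n x) \<longlonglongrightarrow> (LINT x|lborel. indicator {a..b} x *\<^sub>R v x)"
    proof (rule integral_dominated_convergence[where w = "indicator {a..b}"])
      show "AE x in lborel. (\<lambda>n. indicator {a..b} x *\<^sub>R Q n x) \<longlonglongrightarrow> indicator {a..b} x *\<^sub>R v x"
        using AEv by eventually_elim (auto intro!: tendsto_intros)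
    qed (use Q in \<open>auto simp: indicator_def emeasure_lborel_Icc_eq intro!: integrable_real_indicator\<close>)
    moreover have "(LINT x|lborel. indicator {a..b} x *\<^sub>R Q n x) =
        (\<Phi> (b + 1 / Suc n) - \<Phi> b) / (1 / Suc n) - (\<Phi> (a + 1 / Suc n) - \<Phi> a) / (1 / Suc n)" for n
    proof -
      have "set_integrable lborel {a..b} (Q n)" unfolding set_integrable_def
        by (rule integrableI_bounded_set_indicator[where B = 1]) (use Q in \<open>auto simp: emeasure_lborel_Icc_eq\<close>)
      then have "(LINT x|lborel. indicator {a..b} x *\<^sub>R Q n x) = integral {a..b} (Q n)"
        using set_borel_integral_eq_integral(2) by (metis set_lebesgue_integral_def)
      moreover have "((\<lambda>x. F (x + 1 / Suc n)) has_integral \<Phi> (b + 1 / Suc n) - \<Phi> (a + 1 / Suc n)) {a..b}"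
      proof (rule fundamental_theorem_of_calculus[OF that])
        fix x
        have "((\<lambda>x. \<Phi> (x + 1 / Suc n)) has_real_derivative F (x + 1 / Suc n)) (at x within {a..b})"
          by (rule has_field_derivative_at_within[OF iffD1[OF DERIV_shift \<Phi>']])
        then show "((\<lambda>x. \<Phi> (x + 1 / Suc n)) has_vector_derivative F (x + 1 / Suc n)) (at x within {a..b})"
          by (simp add: has_real_derivative_iff_has_vector_derivative)
      qed
      moreover have "(F has_integral \<Phi> b - \<Phi> a) {a..b}"
        using \<Phi> by (intro fundamental_theorem_of_calculus[OF that]) (auto intro: has_vector_derivative_at_within)
      ultimately have "(Q n has_integral ((\<Phi> (b + 1 / Suc n) - \<Phi> (a + 1 / Suc n)) - (\<Phi> b - \<Phi> a)) / (1 / Suc n)) {a..b}"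
        unfolding Q_def by (intro has_integral_divide has_integral_diff)
      moreover have "((A - B) - (C - D)) / h = (A - C) / h - (B - D) / h" for A B C D h :: real
        by (simp add: diff_divide_distrib)
      ultimately show ?thesis
        using \<open>(LINT x|lborel. indicator {a..b} x *\<^sub>R Q n x) = integral {a..b} (Q n)\<close>
        by (metis integral_unique)
    qed
    moreover have "(\<lambda>n. (\<Phi> (b + 1 / Suc n) - \<Phi> b) / (1 / Suc n) - (\<Phi> (a + 1 / Suc n) - \<Phi> a) / (1 / Suc n)) \<longlonglongrightarrow> F b - F a"
      by (intro tendsto_diff D[OF \<Phi>'] refl)
    ultimately have "(LINT x|lborel. indicator {a..b} x *\<^sub>R v x) = F b - F a"
      using LIMSEQ_unique by auto
    then show ?thesis
      using set_borel_integral_eq_integral[OF si] by (auto simp: set_lebesgue_integral_def has_integral_iff)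
  qed
  show ?thesis
    using vm v01 AEv vint by (intro that[of v]) auto
qed

section \<open>Geometry of the distance\<close>

lemma continual_diagramD:
  assumes "continual_diagram \<omega>"
  shows "0 \<le> \<omega> z" "\<bar>\<omega> z1 - \<omega> z2\<bar> \<le> \<bar>z1 - z2\<bar>" "\<exists>C. \<forall>z. C \<le> \<bar>z\<bar> \<longrightarrow> \<omega> z = \<bar>z\<bar>"
  using assms by (auto simp: continual_diagram_def)

text \<open>Far out, at \<open>c\<close> and \<open>- c\<close>, the diagram equals
  \<open>c\<close>; the Lipschitz bound from these two points gives the two signs of
  \<open>z\<close>.\<close>

lemma continual_diagram_ge_abs:
  assumes "continual_diagram \<omega>"
  shows "\<bar>z\<bar> \<le> \<omega> z"
proof -
  obtain C where C: "\<And>z. C \<le> \<bar>z\<bar> \<Longrightarrow> \<omega> z = \<bar>z\<bar>" using continual_diagramD[OF assms] by blast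
  define c where "c = max \<bar>C\<bar> \<bar>z\<bar>"
  have "\<omega> c = c" "\<omega> (- c) = c" using C[of c] C[of "- c"] by (auto simp: c_def)
  moreover have "\<bar>z\<bar> \<le> c" by (auto simp: c_def)
  ultimately show ?thesis
    using continual_diagramD(2)[OF assms, of c z] continual_diagramD(2)[OF assms, of "- c" z] by arith
qed

lemma continual_diagram_continuous_on:
  assumes "continual_diagram \<omega>"
  shows "continuous_on A \<omega>"
proof -
  have "1-lipschitz_on UNIV \<omega>"
    using continual_diagramD(2)[OF assms] by (intro lipschitz_onI) (auto simp: dist_real_def)
  then show ?thesis
    using lipschitz_on_continuous_on continuous_on_subset by blast
qed

lemma continual_diagram_reflect:
  assumes "continual_diagram \<omega>"
  shows "continual_diagram (\<lambda>z. \<omega> (- z))"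
  using assms unfolding continual_diagram_def
  by (metis abs_minus_cancel minus_diff_minus)

text \<open>The reflection \<open>z\<close> to \<open>- z\<close> exchanges the coordinates
  \<open>x\<close> and \<open>y\<close>, so only \<open>dX\<close> needs a direct analysis.\<close>

lemma dY_eq_dX_reflect: "dY \<omega>1 \<omega>2 = dX (\<lambda>z. \<omega>1 (- z)) (\<lambda>z. \<omega>2 (- z))"
proof -
  have "PiY \<omega> x = PiX (\<lambda>z. \<omega> (- z)) x" for \<omega> x
    by (auto simp: PiY_def PiX_def in_diagram_def add.commute)
  then show ?thesis by (simp add: dY_def dX_def)
qed

text \<open>A crude bound uniform in the level \<open>y\<close>, which guarantees that the suprema
  in the distance are taken over bounded sets. For \<open>C \<le> \<bar>x - y\<bar>\<close> the
  diagrams agree; otherwise \<open>x + y \<le> 3 * C\<close>, and the intermediate value theorem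
  finds a point of the section of \<open>\<Omega>\<close> in \<open>[0, y + C]\<close>.\<close>

lemma PiX_nearby:
  assumes \<omega>: "continual_diagram \<omega>" "\<And>z. C \<le> \<bar>z\<bar> \<Longrightarrow> \<omega> z = \<bar>z\<bar>"
    and \<Omega>: "continual_diagram \<Omega>" "\<And>z. C \<le> \<bar>z\<bar> \<Longrightarrow> \<Omega> z = \<bar>z\<bar>"
    and C: "C \<ge> 0" and x: "x \<in> PiX \<omega> y"
  shows "\<exists>x' \<in> PiX \<Omega> y. \<bar>x - x'\<bar> \<le> 4 * C"
proof (cases "C \<le> \<bar>x - y\<bar>")
  case True
  then have "x \<in> PiX \<Omega> y" using x \<omega>(2)[OF True] \<Omega>(2)[OF True] by (auto simp: PiX_def in_diagram_def)
  then show ?thesis using C by (intro bexI[of _ x]) auto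
next
  case False
  have xy: "0 \<le> x" "0 \<le> y" "\<omega> (x - y) = x + y" using x by (auto simp: PiX_def in_diagram_def)
  have "\<bar>\<omega> (x - y) - \<omega> C\<bar> \<le> \<bar>x - y - C\<bar>" using \<omega>(1) continual_diagramD by blast
  then have le: "x + y \<le> 3 * C" using False xy \<omega>(2)[of C] C by auto
  have "\<exists>t\<ge>0. t \<le> y + C \<and> \<Omega> (t - y) - t = y"
  proof (rule IVT2')
    show "\<Omega> (y + C - y) - (y + C) \<le> y" using \<Omega>(2)[of C] C xy by simp
    show "y \<le> \<Omega> (0 - y) - 0" using continual_diagram_ge_abs[OF \<Omega>(1), of "- y"] by simp
    have "continuous_on {0..y + C} (\<Omega> \<circ> (\<lambda>t. t - y))"
      by (intro continuous_on_compose continuous_intros continual_diagram_continuous_on[OF \<Omega>(1)])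
    then show "continuous_on {0..y + C} (\<lambda>t. \<Omega> (t - y) - t)"
      by (intro continuous_intros) (simp add: o_def)
  qed (use C xy in auto)
  then obtain t where t: "0 \<le> t" "t \<le> y + C" "\<Omega> (t - y) = t + y" by fastforce
  then have "t \<in> PiX \<Omega> y" using xy by (auto simp: PiX_def in_diagram_def)
  moreover have "\<bar>x - t\<bar> \<le> 4 * C" using t le xy C by auto
  ultimately show ?thesis by blast
qed

text \<open>The diagram \<open>abs\<close> has the point 0 on every level \<open>y\<close>, and the
  preceding comparison transfers it to \<open>\<Omega>\<close>.\<close>

lemma PiX_nonempty:
  assumes "continual_diagram \<Omega>" "0 \<le> y"
  shows "PiX \<Omega> y \<noteq> {}"
proof -
  obtain C where "\<And>z. C \<le> \<bar>z\<bar> \<Longrightarrow> \<Omega> z = \<bar>z\<bar>" using continual_diagramD[OF assms(1)] by blast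
  moreover have "continual_diagram abs" by (auto simp: continual_diagram_def)
  moreover have "0 \<in> PiX abs y" using assms by (auto simp: PiX_def in_diagram_def)
  ultimately show ?thesis using PiX_nearby[of abs "max C 0" \<Omega> 0 y] assms(1) by auto
qed

lemma closed_PiX:
  assumes "continual_diagram \<Omega>"
  shows "closed (PiX \<Omega> y)"
proof -
  have "continuous_on UNIV (\<Omega> \<circ> (\<lambda>x. x - y))"
    by (intro continuous_on_compose continuous_intros continual_diagram_continuous_on[OF assms])
  then have "closed ({0..} \<inter> {x. 0 \<le> y} \<inter> {x. (\<Omega> \<circ> (\<lambda>x. x - y)) x = x + y})"
    by (intro closed_Int closed_Collect_eq closed_atLeast) (auto intro!: continuous_intros)
  moreover have "PiX \<Omega> y = {0..} \<inter> {x. 0 \<le> y} \<inter> {x. (\<Omega> \<circ> (\<lambda>x. x - y)) x = x + y}"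
    by (auto simp: PiX_def in_diagram_def)
  ultimately show ?thesis by simp
qed

text \<open>The bound \<open>4 * C\<close> makes all suprema genuine upper bounds, and closedness of
  the section turns the infimum distance into a point attaining it.\<close>

lemma dX_le_imp_nearby:
  assumes \<Omega>: "continual_diagram \<Omega>" and \<omega>: "continual_diagram \<omega>" and d: "dX \<Omega> \<omega> \<le> \<epsilon>"
    and x: "x \<in> PiX \<omega> y"
  shows "\<exists>x' \<in> PiX \<Omega> y. \<bar>x - x'\<bar> \<le> \<epsilon>"
proof -
  obtain C1 C2 where C: "\<And>z. C1 \<le> \<bar>z\<bar> \<Longrightarrow> \<Omega> z = \<bar>z\<bar>" "\<And>z. C2 \<le> \<bar>z\<bar> \<Longrightarrow> \<omega> z = \<bar>z\<bar>"
    using continual_diagramD[OF \<Omega>] continual_diagramD[OF \<omega>] by metis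
  define C where "C = max 0 (max C1 C2)"
  have near: "\<exists>x' \<in> PiX \<Omega> y. \<bar>x - x'\<bar> \<le> 4 * C" if "x \<in> PiX \<omega> y" for x y
    by (rule PiX_nearby[OF \<omega> _ \<Omega> _ _ that]) (use C in \<open>auto simp: C_def\<close>)
  have near': "\<exists>x' \<in> PiX \<omega> y. \<bar>x - x'\<bar> \<le> 4 * C" if "x \<in> PiX \<Omega> y" for x y
    by (rule PiX_nearby[OF \<Omega> _ \<omega> _ _ that]) (use C in \<open>auto simp: C_def\<close>)
  have inf: "infdist a (PiX \<Omega> y) \<le> 4 * C" if "a \<in> PiX \<omega> y" for a y
    using near[OF that] infdist_le2[of _ "PiX \<Omega> y" a "4 * C"] by (auto simp: dist_real_def)
  have inf': "infdist a (PiX \<omega> y) \<le> 4 * C" if "a \<in> PiX \<Omega> y" for a y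
    using near'[OF that] infdist_le2[of _ "PiX \<omega> y" a "4 * C"] by (auto simp: dist_real_def)
  have y: "0 \<le> y" using x by (auto simp: PiX_def in_diagram_def)
  have hb: "hausdorff_dist (PiX \<Omega> y) (PiX \<omega> y) \<le> 4 * C" if "0 \<le> y" for y
    unfolding hausdorff_dist_def
    by (intro max.boundedI cSUP_least inf inf' PiX_nonempty that \<Omega> \<omega>)
  have "infdist x (PiX \<Omega> y) \<le> (SUP b\<in>PiX \<omega> y. infdist b (PiX \<Omega> y))"
    by (rule cSUP_upper[OF x]) (use inf in \<open>auto intro!: bdd_aboveI2\<close>)
  also have "\<dots> \<le> hausdorff_dist (PiX \<Omega> y) (PiX \<omega> y)"
    by (simp add: hausdorff_dist_def)
  also have "\<dots> \<le> dX \<Omega> \<omega>" unfolding dX_def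
    by (rule cSUP_upper) (use y hb in \<open>auto intro!: bdd_aboveI2\<close>)
  finally have "infdist x (PiX \<Omega> y) \<le> \<epsilon>" using d by simp
  moreover obtain x' where "x' \<in> PiX \<Omega> y" "infdist x (PiX \<Omega> y) = dist x x'"
    using infdist_attains_inf[OF closed_PiX[OF \<Omega>] PiX_nonempty[OF \<Omega> y]] by blast
  ultimately show ?thesis by (auto simp: dist_real_def)
qed

text \<open>The point \<open>(x, y)\<close> of \<open>\<omega>\<close> above \<open>z\<close> has a
  neighbour \<open>(x', y)\<close> of \<open>\<Omega>\<close> on the same level. Moving along a
  level changes the argument \<open>x - y\<close> and the value \<open>x + y\<close> by the same
  amount, and this displacement cancels against the Lipschitz bound; only \<epsilon> is
  lost.\<close>

lemma dX_le_imp_bounds: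
  assumes \<Omega>: "continual_diagram \<Omega>" and \<omega>: "continual_diagram \<omega>" and d: "dX \<Omega> \<omega> \<le> \<epsilon>"
  shows "\<Omega> (z + \<epsilon>) - \<epsilon> \<le> \<omega> z" and "\<omega> z \<le> \<Omega> (z - \<epsilon>) + \<epsilon>"
proof -
  define x where "x = (\<omega> z + z) / 2"
  define y where "y = (\<omega> z - z) / 2"
  have "x \<in> PiX \<omega> y"
    using continual_diagram_ge_abs[OF \<omega>, of z] by (auto simp: PiX_def in_diagram_def x_def y_def field_simps)
  from dX_le_imp_nearby[OF \<Omega> \<omega> d this]
  obtain x' where x': "\<Omega> (x' - y) = x' + y" "\<bar>x - x'\<bar> \<le> \<epsilon>" by (auto simp: PiX_def in_diagram_def)
  have "z = x - y" "\<omega> z = x + y" by (auto simp: x_def y_def field_simps)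
  then show "\<Omega> (z + \<epsilon>) - \<epsilon> \<le> \<omega> z" "\<omega> z \<le> \<Omega> (z - \<epsilon>) + \<epsilon>"
    using x' continual_diagramD(2)[OF \<Omega>, of "z + \<epsilon>" "x' - y"]
      continual_diagramD(2)[OF \<Omega>, of "z - \<epsilon>" "x' - y"] by auto
qed

text \<open>The lower bound from \<open>dX\<close> and, after reflection, the upper bound from
  \<open>dY\<close> both involve \<Omega> at the same point \<open>z + \<epsilon>\<close>.\<close>

lemma diagram_dist_shift_bound:
  assumes \<Omega>: "continual_diagram \<Omega>" and \<omega>: "continual_diagram \<omega>" and d: "diagram_dist \<Omega> \<omega> \<le> \<epsilon>"
  shows "\<bar>\<omega> z - \<Omega> (z + \<epsilon>)\<bar> \<le> \<epsilon>"
proof -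
  have "dX \<Omega> \<omega> \<le> \<epsilon>" "dX (\<lambda>z. \<Omega> (- z)) (\<lambda>z. \<omega> (- z)) \<le> \<epsilon>"
    using d by (auto simp: diagram_dist_def dY_eq_dX_reflect)
  then show ?thesis
    using dX_le_imp_bounds(1)[OF \<Omega> \<omega>, of \<epsilon> z]
      dX_le_imp_bounds(2)[OF continual_diagram_reflect[OF \<Omega>] continual_diagram_reflect[OF \<omega>], of \<epsilon> "- z"]
    by (auto simp: add.commute abs_le_iff)
qed

section \<open>Cauchy integrals on the line\<close>

text \<open>The Cauchy transform of the signed measure with density \<open>k\<close>; for
  \<open>k\<close> the derivative of \<open>(\<omega> w - \<bar>w\<bar>) / 2\<close>, its negative
  is the exponent in the definition of the transition measure.\<close>

definition line_cauchy :: "(real \<Rightarrow> real) \<Rightarrow> complex \<Rightarrow> complex" where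
  "line_cauchy k z = (\<integral>w. complex_of_real (k w) / (z - complex_of_real w) \<partial>lborel)"

text \<open>Separation from \<open>z\<close> is asked for only where \<open>k\<close> is nonzero, so
  the estimates built on this also apply at real \<open>z\<close> away from that set.\<close>

lemma norm_line_cauchy_kernel_le:
  assumes "0 < \<delta>" "k w \<noteq> 0 \<Longrightarrow> \<delta> \<le> norm (z - complex_of_real w)"
  shows "norm (complex_of_real (k w) / (z - complex_of_real w) ^ n) \<le> \<bar>k w\<bar> / \<delta> ^ n"
proof (cases "k w = 0")
  case False
  then show ?thesis
    using assms by (auto simp: norm_divide norm_power intro!: divide_left_mono power_mono mult_pos_pos zero_less_power)
qed auto

lemma integrable_line_cauchy:
  fixes k :: "real \<Rightarrow> real"
  assumes "integrable lborel k" "0 < \<delta>" "\<And>w. k w \<noteq> 0 \<Longrightarrow> \<delta> \<le> norm (z - complex_of_real w)"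
  shows "integrable lborel (\<lambda>w. complex_of_real (k w) / (z - complex_of_real w))"
    "integrable lborel (\<lambda>w. complex_of_real (k w) / (z - complex_of_real w) ^ n)"
proof -
  have [measurable]: "k \<in> borel_measurable borel" using assms(1) by auto
  show *: "integrable lborel (\<lambda>w. complex_of_real (k w) / (z - complex_of_real w) ^ n)" for n
  proof (rule Bochner_Integration.integrable_bound)
    show "integrable lborel (\<lambda>w. \<bar>k w\<bar> / \<delta> ^ n)" using assms(1) by simp
    show "AE w in lborel. norm (complex_of_real (k w) / (z - complex_of_real w) ^ n) \<le> norm (\<bar>k w\<bar> / \<delta> ^ n)"
      using norm_line_cauchy_kernel_le[OF assms(2,3)] assms(2) by simp
  qed measurable
  show "integrable lborel (\<lambda>w. complex_of_real (k w) / (z - complex_of_real w))"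
    using *[of 1] by simp
qed

lemma norm_line_cauchy_le:
  fixes k :: "real \<Rightarrow> real"
  assumes "integrable lborel k" "0 < \<delta>" "\<And>w. k w \<noteq> 0 \<Longrightarrow> \<delta> \<le> norm (z - complex_of_real w)"
  shows "norm (line_cauchy k z) \<le> (\<integral>w. \<bar>k w\<bar> \<partial>lborel) / \<delta>"
proof -
  have "norm (line_cauchy k z) \<le> (\<integral>w. \<bar>k w\<bar> / \<delta> \<partial>lborel)"
    unfolding line_cauchy_def
    by (rule Bochner_Integration.integral_norm_bound_integral)
       (use assms integrable_line_cauchy[OF assms] norm_line_cauchy_kernel_le[OF assms(2), where n = 1] in auto)
  then show ?thesis by simp
qed

lemma line_cauchy_add:
  fixes k l :: "real \<Rightarrow> real"
  assumes "integrable lborel k" "integrable lborel l" "Im z \<noteq> 0"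
  shows "line_cauchy (\<lambda>w. k w + l w) z = line_cauchy k z + line_cauchy l z"
proof -
  have "\<bar>Im z\<bar> \<le> norm (z - complex_of_real w)" for w
    using abs_Im_le_cmod[of "z - complex_of_real w"] by simp
  then show ?thesis
    unfolding line_cauchy_def using assms integrable_line_cauchy(1)[of _ "\<bar>Im z\<bar>" z]
    by (subst Bochner_Integration.integral_add[symmetric]) (auto simp: add_divide_distrib)
qed

lemma line_cauchy_diff_bound:
  fixes k :: "real \<Rightarrow> real"
  assumes k: "integrable lborel k" and "0 < \<delta>" and z: "\<And>w. k w \<noteq> 0 \<Longrightarrow> \<delta> \<le> norm (z - complex_of_real w)"
    and z': "\<And>w. k w \<noteq> 0 \<Longrightarrow> \<delta> \<le> norm (z' - complex_of_real w)"
  shows "norm (line_cauchy k z' - line_cauchy k z) \<le> norm (z' - z) * ((\<integral>w. \<bar>k w\<bar> \<partial>lborel) / \<delta>\<^sup>2)"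
proof -
  let ?f = "\<lambda>z w. complex_of_real (k w) / (z - complex_of_real w)"
  have "norm (line_cauchy k z' - line_cauchy k z) = norm (\<integral>w. ?f z' w - ?f z w \<partial>lborel)"
    unfolding line_cauchy_def using integrable_line_cauchy(1)[OF k \<open>0 < \<delta>\<close> z] integrable_line_cauchy(1)[OF k \<open>0 < \<delta>\<close> z']
    by (subst Bochner_Integration.integral_diff) auto
  also have "\<dots> \<le> (\<integral>w. norm (z' - z) * (\<bar>k w\<bar> / \<delta>\<^sup>2) \<partial>lborel)"
  proof (rule Bochner_Integration.integral_norm_bound_integral)
    fix w
    show "norm (?f z' w - ?f z w) \<le> norm (z' - z) * (\<bar>k w\<bar> / \<delta>\<^sup>2)"
    proof (cases "k w = 0")
      case False
      let ?a = "z' - complex_of_real w" and ?b = "z - complex_of_real w"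
      have *: "\<delta> \<le> norm ?a" "\<delta> \<le> norm ?b" using z z' False by auto
      then have "?a \<noteq> 0" "?b \<noteq> 0" using \<open>0 < \<delta>\<close> by auto
      then have "?f z' w - ?f z w = k w * (z - z') / (?a * ?b)"
        by (simp add: field_simps)
      then have "norm (?f z' w - ?f z w) = \<bar>k w\<bar> * norm (z' - z) / (norm ?a * norm ?b)"
        by (simp add: norm_mult norm_divide norm_minus_commute)
      also have "\<dots> \<le> \<bar>k w\<bar> * norm (z' - z) / \<delta>\<^sup>2"
        unfolding power2_eq_square using * \<open>0 < \<delta>\<close> by (intro divide_left_mono mult_mono mult_pos_pos) auto
      finally show ?thesis by (simp add: mult.commute)
    qed auto
  qed (use k integrable_line_cauchy(1)[OF k \<open>0 < \<delta>\<close> z] integrable_line_cauchy(1)[OF k \<open>0 < \<delta>\<close> z'] in auto)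
  finally show ?thesis by simp
qed

text \<open>With \<open>a = z' - w\<close> and \<open>b = z - w\<close>, the difference quotient of
  the kernel differs from its derivative by \<open>(a - b) / (a * b^2)\<close>. Near
  \<open>z\<close> both \<open>a\<close> and \<open>b\<close> have norm at least
  \<open>Im z / 2\<close>, so the error is of order \<open>norm (z' - z)\<close> uniformly in
  \<open>w\<close>.\<close>

lemma line_cauchy_has_derivative:
  fixes k :: "real \<Rightarrow> real"
  assumes k: "integrable lborel k" and z: "0 < Im z"
  shows "(line_cauchy k has_field_derivative - (\<integral>w. complex_of_real (k w) / (z - complex_of_real w)\<^sup>2 \<partial>lborel)) (at z)"
proof -
  let ?D = "\<integral>w. complex_of_real (k w) / (z - complex_of_real w)\<^sup>2 \<partial>lborel"
  define \<delta> where "\<delta> = Im z / 2"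
  have \<delta>: "0 < \<delta>" using z by (simp add: \<delta>_def)
  have sep: "\<delta> \<le> norm (z' - complex_of_real w)" if "norm (z' - z) < \<delta>" for z' w
    using that abs_Im_le_cmod[of "z' - z"] abs_Im_le_cmod[of "z' - complex_of_real w"]
    by (simp add: \<delta>_def abs_if split: if_splits)
  have sepz: "\<delta> \<le> norm (z - complex_of_real w)" for w using sep[of z] \<delta> by simp
  have alg: "(1 / a - 1 / b) / (a - b) + 1 / b\<^sup>2 = (a - b) / (a * b\<^sup>2)"
    if "a \<noteq> 0" "b \<noteq> 0" "a \<noteq> b" for a b :: complex
  proof -
    have "1 / a - 1 / b = (a - b) * (- 1 / (a * b))" using that by (simp add: field_simps)
    then have "(1 / a - 1 / b) / (a - b) = - 1 / (a * b)" using that(3) by simp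
    moreover have "- 1 / (a * b) + 1 / b\<^sup>2 = (a - b) / (a * b\<^sup>2)"
      using that(1,2) by (simp add: field_simps power2_eq_square)
    ultimately show ?thesis by simp
  qed
  define B where "B = (\<integral>w. \<bar>k w\<bar> \<partial>lborel) / \<delta> ^ 3"
  have "norm ((line_cauchy k z' - line_cauchy k z) / (z' - z) - (- ?D)) \<le> norm (z' - z) * B"
    if z': "norm (z' - z) < \<delta>" "z' \<noteq> z" for z'
  proof -
    let ?f = "\<lambda>z w. complex_of_real (k w) / (z - complex_of_real w)"
    have i: "integrable lborel (?f z')" "integrable lborel (?f z)"
       "integrable lborel (\<lambda>w. complex_of_real (k w) / (z - complex_of_real w)\<^sup>2)"
      using integrable_line_cauchy[OF k \<delta> sep[OF z'(1)]] integrable_line_cauchy[OF k \<delta> sepz] by auto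
    have "(line_cauchy k z' - line_cauchy k z) / (z' - z) - (- ?D) =
       (\<integral>w. (?f z' w - ?f z w) / (z' - z) + complex_of_real (k w) / (z - complex_of_real w)\<^sup>2 \<partial>lborel)"
      unfolding line_cauchy_def using i by (subst Bochner_Integration.integral_add) auto
    also have "norm \<dots> \<le> (\<integral>w. norm (z' - z) * (\<bar>k w\<bar> / \<delta> ^ 3) \<partial>lborel)"
    proof (rule Bochner_Integration.integral_norm_bound_integral)
      fix w
      let ?a = "z' - complex_of_real w" and ?b = "z - complex_of_real w"
      have *: "\<delta> \<le> norm ?a" "\<delta> \<le> norm ?b" using sep[OF z'(1)] sepz by auto
      then have n0: "?a \<noteq> 0" "?b \<noteq> 0" using \<delta> by auto
      have eq: "(1 / ?a - 1 / ?b) / (z' - z) + 1 / ?b\<^sup>2 = (z' - z) / (?a * ?b\<^sup>2)"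
        using alg[OF n0] z'(2) by simp
      have "(?f z' w - ?f z w) / (z' - z) + complex_of_real (k w) / ?b\<^sup>2
          = k w * ((1 / ?a - 1 / ?b) / (z' - z) + 1 / ?b\<^sup>2)"
        by (simp add: ring_distribs diff_divide_distrib)
      also have "norm \<dots> = \<bar>k w\<bar> * norm (z' - z) / (norm ?a * norm ?b ^ 2)"
        unfolding eq by (simp add: norm_mult norm_divide norm_power)
      also have "\<dots> \<le> \<bar>k w\<bar> * norm (z' - z) / (\<delta> * \<delta>\<^sup>2)"
        using * \<delta> by (intro divide_left_mono mult_mono power_mono mult_pos_pos zero_less_power) auto
      finally show "norm ((?f z' w - ?f z w) / (z' - z) + complex_of_real (k w) / ?b\<^sup>2) \<le> norm (z' - z) * (\<bar>k w\<bar> / \<delta> ^ 3)"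
        by (simp add: power3_eq_cube power2_eq_square mult.commute mult.left_commute)
    qed (use i k in auto)
    finally show ?thesis by (simp add: B_def)
  qed
  then have "\<forall>\<^sub>F z' in at z. norm ((line_cauchy k z' - line_cauchy k z) / (z' - z) - (- ?D)) \<le> norm (z' - z) * B"
    using \<delta> by (auto simp: eventually_at dist_norm intro!: exI[of _ \<delta>])
  moreover have "((\<lambda>z'. norm (z' - z) * B) \<longlongrightarrow> 0) (at z)"
    by (rule tendsto_eq_intros refl | simp)+
  ultimately have "((\<lambda>z'. (line_cauchy k z' - line_cauchy k z) / (z' - z) - (- ?D)) \<longlongrightarrow> 0) (at z)"
    by (rule Lim_null_comparison)
  then show ?thesis unfolding has_field_derivative_iff by (rule LIM_zero_cancel)
qed

lemma line_cauchy_holomorphic_on: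
  fixes k :: "real \<Rightarrow> real"
  assumes k: "integrable lborel k"
  shows "line_cauchy k holomorphic_on {z. 0 < Im z}"
  using line_cauchy_has_derivative[OF k] by (intro holomorphic_onI) (metis field_differentiable_def field_differentiable_at_within mem_Collect_eq)

lemma line_cauchy_interval:
  assumes "a \<le> b" and z: "0 < Im z"
  shows "line_cauchy (indicator {a..b}) z = Ln (z - a) - Ln (z - b)"
proof -
  have nr: "z - complex_of_real w \<notin> \<real>\<^sub>\<le>\<^sub>0" for w using z by (auto simp: complex_nonpos_Reals_iff)
  have nz: "z - complex_of_real w \<noteq> 0" for w using z by (auto simp: complex_eq_iff)
  have "continuous_on {a..b} (\<lambda>w. 1 / (z - complex_of_real w))"
    using nz by (intro continuous_intros) auto
  then have int: "set_integrable lborel {a..b} (\<lambda>w. 1 / (z - complex_of_real w))"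
    unfolding set_integrable_def by (intro borel_integrable_compact) auto
  have "((\<lambda>w. 1 / (z - complex_of_real w)) has_integral (- Ln (z - b)) - (- Ln (z - a))) {a..b}"
  proof (rule fundamental_theorem_of_calculus[OF assms(1)])
    fix x
    have "((\<lambda>w. - Ln (z - w)) has_field_derivative 1 / (z - complex_of_real x)) (at (complex_of_real x))"
      using nr[of x] by (auto intro!: derivative_eq_intros simp: divide_inverse)
    then show "((\<lambda>w. - Ln (z - complex_of_real w)) has_vector_derivative 1 / (z - complex_of_real x)) (at x within {a..b})"
      by (rule has_vector_derivative_real_field)
  qed
  then have "(LBINT w:{a..b}. 1 / (z - complex_of_real w)) = Ln (z - a) - Ln (z - b)"
    using set_borel_integral_eq_integral(2)[OF int] by (simp add: integral_unique)
  moreover have "line_cauchy (indicator {a..b}) z = (LBINT w:{a..b}. 1 / (z - complex_of_real w))"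
    unfolding line_cauchy_def set_lebesgue_integral_def
    by (intro Bochner_Integration.integral_cong) (auto simp: indicator_def)
  ultimately show ?thesis by simp
qed

text \<open>The exponential representation of a Cauchy transform: if \<open>u\<close> is the density
  \<open>(1 + \<omega>') / 2\<close> of a diagram, cut off to a large enough \<open>[-M, M]\<close>,
  this is the Cauchy transform of its transition measure. It makes sense for other densities
  \<open>u\<close> without reference to any measure.\<close>

definition krein_transform :: "real \<Rightarrow> (real \<Rightarrow> real) \<Rightarrow> complex \<Rightarrow> complex" where
  "krein_transform M u z = exp (- line_cauchy u z) / (z - complex_of_real M)"

lemma integrable_bounded_support:
  fixes k :: "real \<Rightarrow> real"
  assumes "k \<in> borel_measurable borel" "\<And>w. \<bar>k w\<bar> \<le> B" "\<And>w. M < \<bar>w\<bar> \<Longrightarrow> k w = 0"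
  shows "integrable lborel k"
  by (rule integrableI_bounded_set[where A = "{-M..M}" and B = B])
     (use assms in \<open>auto simp: emeasure_lborel_Icc_eq\<close>)

text \<open>Minus the imaginary part of the kernel is the positive function
  \<open>Im z / norm (z - w)^2\<close>, pi times the Poisson kernel, so inequalities between
  densities pass to the integrals.\<close>

lemma Im_line_cauchy:
  fixes k :: "real \<Rightarrow> real"
  assumes "integrable lborel k" "0 < Im z"
  shows "integrable lborel (\<lambda>w. k w * (Im z / (norm (z - complex_of_real w))\<^sup>2))"
    "- Im (line_cauchy k z) = (\<integral>w. k w * (Im z / (norm (z - complex_of_real w))\<^sup>2) \<partial>lborel)"
proof -
  have "Im z \<le> norm (z - complex_of_real w)" for w
    using abs_Im_le_cmod[of "z - complex_of_real w"] assms by simp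
  then have i: "integrable lborel (\<lambda>w. complex_of_real (k w) / (z - complex_of_real w))"
    using assms by (intro integrable_line_cauchy(1)) auto
  have eq: "Im (complex_of_real (k w) / (z - complex_of_real w)) = - (k w * (Im z / (norm (z - complex_of_real w))\<^sup>2))" for w
    by (simp add: Im_divide cmod_power2)
  show "integrable lborel (\<lambda>w. k w * (Im z / (norm (z - complex_of_real w))\<^sup>2))"
    using integrable_Im[OF i] unfolding eq by simp
  show "- Im (line_cauchy k z) = (\<integral>w. k w * (Im z / (norm (z - complex_of_real w))\<^sup>2) \<partial>lborel)"
    unfolding line_cauchy_def integral_Im[OF i, symmetric] eq by simp
qed

section \<open>Densities with values in [0, 1]: sign and total mass of the transform on horizontal
  lines\<close>

context
  fixes M :: real and u :: "real \<Rightarrow> real"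
  assumes M: "0 < M" and um: "u \<in> borel_measurable borel"
    and u0: "\<And>w. 0 \<le> u w" and u1: "\<And>w. u w \<le> 1" and us: "\<And>w. M < \<bar>w\<bar> \<Longrightarrow> u w = 0"
begin

lemma integrable_density: "integrable lborel u"
proof (rule integrable_bounded_support[OF um _ us])
  show "\<bar>u w\<bar> \<le> 1" for w using u0[of w] u1[of w] by simp
qed

text \<open>Since \<open>u\<close> lies between 0 and the indicator of \<open>[-M, M]\<close>, the
  argument of the exponential representation lies between minus the argument of \<open>z - M\<close>
  and minus that of \<open>z + M\<close>. Both are in \<open>(-pi, 0)\<close>, where the sine is
  negative.\<close>

lemma krein_transform_Im_le_0:
  assumes z: "0 < Im z"
  shows "Im (krein_transform M u z) \<le> 0"
proof -
  let ?I = "indicator {-M..M} :: real \<Rightarrow> real"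
  have iI: "integrable lborel ?I"
    using M by (intro integrable_real_indicator) (auto simp: emeasure_lborel_Icc_eq)
  have pos: "0 < Im (Ln (z - complex_of_real c)) \<and> Im (Ln (z - complex_of_real c)) < pi" for c
    using z Im_Ln_pos_lt[of "z - complex_of_real c"] by (auto simp: complex_eq_iff)
  have nz: "z - complex_of_real M \<noteq> 0" using z by (auto simp: complex_eq_iff)
  have "0 \<le> - Im (line_cauchy u z)"
    unfolding Im_line_cauchy(2)[OF integrable_density z] using u0 z by (intro Bochner_Integration.integral_nonneg) auto
  moreover have "- Im (line_cauchy u z) \<le> - Im (line_cauchy ?I z)"
    unfolding Im_line_cauchy(2)[OF integrable_density z] Im_line_cauchy(2)[OF iI z]
  proof (intro Bochner_Integration.integral_mono Im_line_cauchy(1) integrable_density iI z mult_right_mono)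
    show "u w \<le> ?I w" for w
      using u1[of w] us[of w] by (cases "M < \<bar>w\<bar>") (auto simp: indicator_def)
  qed (use z in auto)
  moreover have "line_cauchy ?I z = Ln (z - complex_of_real (- M)) - Ln (z - complex_of_real M)"
    using M z by (intro line_cauchy_interval) auto
  ultimately have "- pi \<le> Im (- line_cauchy u z - Ln (z - complex_of_real M))"
     "Im (- line_cauchy u z - Ln (z - complex_of_real M)) \<le> 0"
    using pos[of M] pos[of "- M"] by auto
  then have "sin (Im (- line_cauchy u z - Ln (z - complex_of_real M))) \<le> 0"
    using sin_ge_zero[of "- t" for t] sin_minus by (metis neg_0_le_iff_le neg_le_iff_le add.inverse_inverse)
  moreover have "krein_transform M u z = exp (- line_cauchy u z - Ln (z - complex_of_real M))"
    using nz by (simp add: krein_transform_def exp_diff)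
  ultimately show ?thesis by (simp add: Im_exp mult_nonneg_nonpos)
qed

text \<open>The total mass of \<open>u\<close> is at most \<open>2 * M\<close>, so for large
  \<open>z\<close> the exponent is of order \<open>M / norm z\<close> and the exponential is close
  to 1.\<close>

lemma krein_transform_asymptotics:
  assumes z: "8 * M \<le> norm z"
  shows "norm (krein_transform M u z - 1 / (z - complex_of_real M)) \<le> 12 * M / (norm z)\<^sup>2"
proof -
  have z0: "0 < norm z" using z M by auto
  have sep: "norm z / 2 \<le> norm (z - complex_of_real w)" if "\<bar>w\<bar> \<le> M" for w
    using norm_triangle_ineq2[of z "complex_of_real w"] that z by auto
  have "(\<integral>w. \<bar>u w\<bar> \<partial>lborel) \<le> (\<integral>w. indicator {-M..M} w \<partial>lborel)"
  proof (rule Bochner_Integration.integral_mono)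
    show "integrable lborel (indicator {-M..M} :: real \<Rightarrow> real)"
      using M by (intro integrable_real_indicator) (auto simp: emeasure_lborel_Icc_eq)
    show "\<bar>u w\<bar> \<le> indicator {-M..M} w" for w
      using u0[of w] u1[of w] us[of w] by (cases "M < \<bar>w\<bar>") (auto simp: indicator_def)
  qed (use integrable_density in auto)
  then have "(\<integral>w. \<bar>u w\<bar> \<partial>lborel) \<le> 2 * M" using M by simp
  moreover have "norm (line_cauchy u z) \<le> (\<integral>w. \<bar>u w\<bar> \<partial>lborel) / (norm z / 2)"
    using us sep z0 by (intro norm_line_cauchy_le integrable_density) (auto simp: not_le[symmetric])
  ultimately have lc: "norm (line_cauchy u z) \<le> 4 * M / norm z"
    using z0 by (auto simp: field_simps intro: order_trans)
  \<comment> \<open>The threshold \<open>8 * M\<close> makes the exponent at most 1/2 in norm, the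
    range of the linear bound for \<open>exp x - 1\<close>.\<close>
  moreover have "4 * M / norm z \<le> 1 / 2" using z z0 by (simp add: field_simps)
  ultimately have "norm (exp (- line_cauchy u z) - 1) \<le> 3 / 2 * norm (- line_cauchy u z)"
    by (intro norm_exp_bounds(2)) auto
  then have e: "norm (exp (- line_cauchy u z) - 1) \<le> 6 * M / norm z" using lc by simp
  have "krein_transform M u z - 1 / (z - complex_of_real M) = (exp (- line_cauchy u z) - 1) / (z - complex_of_real M)"
    by (simp add: krein_transform_def diff_divide_distrib)
  also have "norm \<dots> \<le> (6 * M / norm z) / (norm z / 2)"
    unfolding norm_divide using sep[of M] M z0 by (intro frac_le e) auto
  finally show ?thesis using z0 by (simp add: power2_eq_square)
qed

lemma krein_transform_holomorphic: "krein_transform M u holomorphic_on {z. 0 < Im z}"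
proof -
  have "z - complex_of_real M \<noteq> 0" if "0 < Im z" for z using that by (auto simp: complex_eq_iff)
  then show ?thesis unfolding krein_transform_def
    by (intro holomorphic_intros line_cauchy_holomorphic_on integrable_density) auto
qed

lemma continuous_krein_transform_line:
  assumes "0 < y"
  shows "continuous_on A (\<lambda>x. krein_transform M u (Complex x y))"
proof -
  have "continuous_on {z. 0 < Im z} (krein_transform M u)"
    by (rule holomorphic_on_imp_continuous_on[OF krein_transform_holomorphic])
  then show ?thesis
    by (rule continuous_on_compose2) (use assms in \<open>auto simp: Complex_eq intro!: continuous_intros\<close>)
qed

text \<open>By Cauchy's theorem the segment may be replaced by the upper semicircle of radius
  \<open>A\<close>, of length \<open>pi * A\<close>, on which the difference is at most
  \<open>12 * M / A^2\<close>.\<close>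

lemma krein_transform_semicircle:
  assumes y: "0 < y" and A: "8 * M \<le> A"
  shows "norm (integral {-A..A} (\<lambda>x. krein_transform M u (Complex x y) - 1 / (Complex x y - complex_of_real M))) \<le> 12 * pi * M / A"
proof -
  \<comment> \<open>The translation by \<open>\<i> * y\<close> puts the segment on the real axis,
    inside the half-plane \<open>S\<close> where \<open>g\<close> is holomorphic.\<close>
  define g where "g \<zeta> = krein_transform M u (\<zeta> + \<i> * y) - 1 / (\<zeta> + \<i> * y - complex_of_real M)" for \<zeta>
  define S where "S = {\<zeta>. - y < Im \<zeta>}"
  have A0: "0 < A" using A M by simp
  have "(krein_transform M u \<circ> (\<lambda>\<zeta>. \<zeta> + \<i> * y)) holomorphic_on S"
    by (rule holomorphic_on_compose_gen[OF _ krein_transform_holomorphic]) (auto simp: S_def intro!: holomorphic_intros)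
  moreover have "\<zeta> + \<i> * y - complex_of_real M \<noteq> 0" if "\<zeta> \<in> S" for \<zeta> using that by (auto simp: complex_eq_iff S_def)
  ultimately have hol: "g holomorphic_on S"
    unfolding g_def by (intro holomorphic_intros) (auto simp: o_def)
  have "convex S" unfolding S_def by (rule convex_halfspace_Im_gt)
  define \<gamma> where "\<gamma> = linepath (complex_of_real (- A)) (complex_of_real A)"
  define c where "c = part_circlepath 0 A 0 pi"
  have ci: "z \<in> S \<and> norm z = A \<and> 0 \<le> Im z" if "z \<in> path_image c" for z
    using that A0 y by (auto simp: c_def S_def path_image_part_circlepath norm_mult Im_exp sin_ge_zero intro: less_le_trans[of _ 0])
  have ends: "pathstart c = A" "pathfinish c = - A" "pathstart \<gamma> = - A" "pathfinish \<gamma> = A"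
    by (auto simp: c_def \<gamma>_def)
  have gi: "path_image \<gamma> \<subseteq> S"
    unfolding \<gamma>_def path_image_linepath using \<open>convex S\<close> y by (intro closed_segment_subset) (auto simp: S_def)
  have vp: "valid_path \<gamma>" "valid_path c" by (auto simp: \<gamma>_def c_def)
  have "(g has_contour_integral 0) (\<gamma> +++ c)"
    using vp ci gi ends by (intro Cauchy_theorem_convex_simple[OF hol \<open>convex S\<close>])
      (auto simp: path_image_join valid_path_join)
  moreover have "open S" unfolding S_def by (rule open_halfspace_Im_gt)
  then have int: "g contour_integrable_on \<gamma>" "g contour_integrable_on c"
    using contour_integrable_holomorphic_simple[OF hol] vp gi ci by blast+
  ultimately have "contour_integral \<gamma> g + contour_integral c g = 0"
    using vp contour_integral_unique by (metis contour_integral_join)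
  then have "norm (contour_integral \<gamma> g) = norm (contour_integral c g)"
    by (metis add_eq_0_iff2 norm_minus_cancel)
  also have "\<dots> \<le> (12 * M / A\<^sup>2) * A * \<bar>pi - 0\<bar>"
    unfolding c_def
  proof (rule contour_integral_bound_part_circlepath)
    show "g contour_integrable_on part_circlepath 0 A 0 pi" using int by (simp add: c_def)
    fix z assume "z \<in> path_image (part_circlepath 0 A 0 pi)"
    then have z: "norm z = A" "0 \<le> Im z" using ci by (auto simp: c_def)
    \<comment> \<open>Moving a point of the closed upper half-plane upwards does not decrease its
      norm, so the asymptotic estimate is available on the translated arc.\<close>
    then have "norm z \<le> norm (z + \<i> * y)"
      using y by (auto simp: cmod_def intro!: real_sqrt_le_mono add_mono power_mono)
    then have "A \<le> norm (z + \<i> * y)" using z by simp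
    then have "norm (g z) \<le> 12 * M / (norm (z + \<i> * y))\<^sup>2"
      unfolding g_def using A by (intro krein_transform_asymptotics) auto
    also have "\<dots> \<le> 12 * M / A\<^sup>2"
      using \<open>A \<le> norm (z + \<i> * y)\<close> A0 M by (intro divide_left_mono power_mono mult_pos_pos zero_less_power) auto
    finally show "norm (g z) \<le> 12 * M / A\<^sup>2" .
  qed (use M A0 in auto)
  also have "\<dots> = 12 * pi * M / A" using A0 by (simp add: power2_eq_square)
  also have "contour_integral \<gamma> g = integral {-A..A} (\<lambda>x. g (complex_of_real x))"
    unfolding \<gamma>_def using A0 by (subst contour_integral_linepath_Reals_eq) auto
  finally show ?thesis by (simp add: g_def Complex_eq)
qed

text \<open>As the integrand is nonnegative, \<open>[a, b]\<close> may be enlarged to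
  \<open>[-A, A]\<close>. There \<open>1 / (z - M)\<close> contributes a difference of two
  arctangents, at most pi, and the remainder vanishes as \<open>A\<close> tends to infinity.\<close>

lemma krein_transform_line_integral_le_pi:
  assumes y: "0 < y" and "a \<le> b"
  shows "integral {a..b} (\<lambda>x. - Im (krein_transform M u (Complex x y))) \<le> pi"
proof -
  let ?h = "\<lambda>x. - Im (krein_transform M u (Complex x y))"
  have io: "?h integrable_on {c..d}" for c d
    by (intro integrable_continuous_real continuous_intros continuous_krein_transform_line y)
  have h0: "0 \<le> ?h x" for x using krein_transform_Im_le_0[of "Complex x y"] y by auto
  have *: "integral {a..b} ?h \<le> pi + 12 * pi * M / A" if A: "8 * M \<le> A" "\<bar>a\<bar> \<le> A" "\<bar>b\<bar> \<le> A" for A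
  proof -
    let ?p = "\<lambda>x. 1 / (Complex x y - complex_of_real M)"
    have A0: "0 < A" using A M by auto
    have nz: "Complex x y - complex_of_real M \<noteq> 0" for x using y by (auto simp: complex_eq_iff)
    have cp: "continuous_on {-A..A} ?p"
      using nz by (intro continuous_intros) (auto simp: Complex_eq intro!: continuous_intros)
    have ck: "continuous_on {-A..A} (\<lambda>x. krein_transform M u (Complex x y))"
      by (rule continuous_krein_transform_line[OF y])
    have ip: "((\<lambda>x. - Im (?p x)) has_integral (arctan ((A - M) / y) - arctan ((- A - M) / y))) {-A..A}"
    proof (rule fundamental_theorem_of_calculus)
      fix x
      have "((\<lambda>x. arctan ((x - M) / y)) has_real_derivative - Im (?p x)) (at x within {-A..A})"
        using y by (auto intro!: derivative_eq_intros simp: Im_divide power2_eq_square field_simps)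
      then show "((\<lambda>x. arctan ((x - M) / y)) has_vector_derivative - Im (?p x)) (at x within {-A..A})"
        by (simp add: has_real_derivative_iff_has_vector_derivative)
    qed (use A0 in auto)
    have "integral {a..b} ?h \<le> integral {-A..A} ?h"
      using A h0 by (intro integral_subset_le io) auto
    also have "\<dots> = integral {-A..A} (\<lambda>x. - Im (?p x)) + integral {-A..A} (\<lambda>x. - Im (krein_transform M u (Complex x y) - ?p x))"
      by (subst integral_add[symmetric])
         (auto intro!: integrable_continuous_real continuous_on_minus continuous_on_Im continuous_on_diff cp ck)
    also have "integral {-A..A} (\<lambda>x. - Im (?p x)) \<le> pi"
      using integral_unique[OF ip] arctan_ubound[of "(A - M) / y"] arctan_lbound[of "(- A - M) / y"] by simp
    also have "integral {-A..A} (\<lambda>x. - Im (krein_transform M u (Complex x y) - ?p x))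
      = - Im (integral {-A..A} (\<lambda>x. krein_transform M u (Complex x y) - ?p x))"
    proof -
      have "(\<lambda>x. krein_transform M u (Complex x y) - ?p x) integrable_on {-A..A}"
        by (intro integrable_continuous_real continuous_on_diff cp ck)
      from integral_linear[OF this bounded_linear_Im] show ?thesis by (simp only: o_def integral_neg)
    qed
    also have "\<dots> \<le> norm (integral {-A..A} (\<lambda>x. krein_transform M u (Complex x y) - ?p x))"
      using abs_Im_le_cmod[of "integral {-A..A} (\<lambda>x. krein_transform M u (Complex x y) - ?p x)"] by linarith
    also have "\<dots> \<le> 12 * pi * M / A" by (rule krein_transform_semicircle[OF y A(1)])
    finally show ?thesis by simp
  qed
  have "((\<lambda>A. pi + 12 * pi * M / A) \<longlongrightarrow> pi + 0) at_top"
    by (intro tendsto_intros tendsto_divide_0[OF tendsto_const] filterlim_at_top_imp_at_infinity filterlim_ident)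
  moreover have "\<forall>\<^sub>F A in at_top. integral {a..b} ?h \<le> pi + 12 * pi * M / A"
    using eventually_ge_at_top[of "max (8 * M) (max \<bar>a\<bar> \<bar>b\<bar>)"] by eventually_elim (rule *, auto)
  ultimately show ?thesis using tendsto_lowerbound trivial_limit_at_top_linorder by fastforce
qed

end

section \<open>Stieltjes inversion\<close>

lemma cauchy_density_integral:
  "integrable lborel (\<lambda>s::real. 1 / (1 + s\<^sup>2))" "(\<integral>s. 1 / (1 + s\<^sup>2) \<partial>lborel) = pi"
proof -
  have e: "einterval (-\<infinity>) \<infinity> = UNIV" by (auto simp: einterval_def)
  show "integrable lborel (\<lambda>s::real. 1 / (1 + s\<^sup>2))"
    using integrable_inverse_1_plus_square by (simp add: e set_integrable_def inverse_eq_divide)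
  show "(\<integral>s. 1 / (1 + s\<^sup>2) \<partial>lborel) = pi"
    using LBINT_inverse_1_plus_square
    by (simp add: interval_lebesgue_integral_def e set_lebesgue_integral_def inverse_eq_divide)
qed

lemma norm_Complex_minus_real_ge: "\<bar>y\<bar> \<le> norm (Complex x y - complex_of_real t)"
  using abs_Im_le_cmod[of "Complex x y - complex_of_real t"] by simp

lemma norm_inverse_Complex_minus_real_le:
  assumes "0 < y"
  shows "norm (1 / (Complex x y - complex_of_real t)) \<le> 1 / y"
  using norm_Complex_minus_real_ge[of y x t] assms unfolding norm_divide by (intro frac_le) auto

context
  fixes \<nu> :: "real measure" and y :: "nat \<Rightarrow> real"
  assumes \<nu>: "prob_space \<nu>" and sets\<nu>: "sets \<nu> = sets borel"
    and y0: "\<And>n. 0 < y n" and y: "y \<longlonglongrightarrow> 0"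
begin

interpretation prob_space \<nu> by (rule \<nu>)

lemma integrable_cauchy_kernel:
  assumes "0 < Y"
  shows "integrable \<nu> (\<lambda>t. 1 / (Complex x Y - complex_of_real t))"
proof -
  note [measurable_cong] = sets\<nu>
  show ?thesis
    by (rule integrable_const_bound[where B = "1 / Y"])
       (use norm_inverse_Complex_minus_real_le[OF assms] in auto)
qed

lemma cauchy_transform_measurable:
  "(\<lambda>x. cauchy_transform \<nu> (Complex x Y)) \<in> borel_measurable borel"
proof -
  note [measurable_cong] = sets\<nu>
  show ?thesis unfolding cauchy_transform_def Complex_eq by measurable
qed

text \<open>Fubini applies the Poisson kernel to the test function instead of the measure. The
  substitution \<open>x = t + Y * s\<close> turns the inner integral into one of
  \<open>\<psi> (t + Y * s)\<close> against the fixed Cauchy density, and dominated convergence is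
  used first in \<open>s\<close> and then in \<open>t\<close>.\<close>

lemma poisson_limit:
  fixes \<psi> :: "real \<Rightarrow> real"
  assumes \<psi>: "continuous_on UNIV \<psi>" and B: "\<And>x. \<bar>\<psi> x\<bar> \<le> B" and sup: "\<And>x. x \<notin> {a..b} \<Longrightarrow> \<psi> x = 0"
  shows "(\<lambda>n. \<integral>x. \<psi> x * (- Im (cauchy_transform \<nu> (Complex x (y n)))) \<partial>lborel) \<longlonglongrightarrow> pi * (\<integral>t. \<psi> t \<partial>\<nu>)"
proof -
  note [measurable_cong] = sets\<nu>
  have \<psi>m [measurable]: "\<psi> \<in> borel_measurable borel" using \<psi> by (rule borel_measurable_continuous_onI)
  define P where "P Y x t = Y / ((x - t)\<^sup>2 + Y\<^sup>2)" for Y x t :: real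
  have Pm [measurable]: "(\<lambda>(x, t). P Y x t) \<in> borel_measurable (borel \<Otimes>\<^sub>M borel)" for Y
    unfolding P_def by measurable
  have P: "0 \<le> P Y x t" "P Y x t \<le> 1 / Y" if "0 < Y" for Y x t
  proof -
    have "0 < (x - t)\<^sup>2 + Y\<^sup>2" using that by (intro add_nonneg_pos) auto
    then show "0 \<le> P Y x t" using that by (simp add: P_def)
    have "P Y x t \<le> Y / Y\<^sup>2" unfolding P_def
      using that \<open>0 < (x - t)\<^sup>2 + Y\<^sup>2\<close> by (intro divide_left_mono) auto
    then show "P Y x t \<le> 1 / Y" using that by (simp add: power2_eq_square)
  qed
  interpret pair: pair_sigma_finite lborel \<nu> ..
  have step: "(\<integral>x. \<psi> x * (- Im (cauchy_transform \<nu> (Complex x Y))) \<partial>lborel)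
      = (\<integral>t. (\<integral>s. \<psi> (t + Y * s) / (1 + s\<^sup>2) \<partial>lborel) \<partial>\<nu>)" if Y: "0 < Y" for Y
  proof -
    have "- Im (cauchy_transform \<nu> (Complex x Y)) = (\<integral>t. P Y x t \<partial>\<nu>)" for x
    proof -
      have "Im (1 / (Complex x Y - complex_of_real t)) = - P Y x t" for t
        by (simp add: Im_divide P_def)
      then show ?thesis
        unfolding cauchy_transform_def integral_Im[OF integrable_cauchy_kernel[OF Y], symmetric] by simp
    qed
    then have "(\<integral>x. \<psi> x * (- Im (cauchy_transform \<nu> (Complex x Y))) \<partial>lborel) = (\<integral>x. (\<integral>t. \<psi> x * P Y x t \<partial>\<nu>) \<partial>lborel)"
      by simp
    also have "\<dots> = (\<integral>t. (\<integral>x. \<psi> x * P Y x t \<partial>lborel) \<partial>\<nu>)"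
    proof (rule pair.Fubini_integral[symmetric])
      show "integrable (lborel \<Otimes>\<^sub>M \<nu>) (\<lambda>(x, t). \<psi> x * P Y x t)"
      proof (rule integrableI_bounded_set[where A = "{a..b} \<times> space \<nu>" and B = "B * (1 / Y)"])
        show "emeasure (lborel \<Otimes>\<^sub>M \<nu>) ({a..b} \<times> space \<nu>) < \<infinity>"
          by (subst emeasure_pair_measure_Times) (auto simp: emeasure_space_1 emeasure_lborel_Icc_eq)
        have "norm (\<psi> x * P Y x t) \<le> B * (1 / Y)" for x t
          unfolding norm_mult using B[of x] P[OF Y, of x t] by (intro mult_mono) auto
        then show "AE p in lborel \<Otimes>\<^sub>M \<nu>. p \<in> {a..b} \<times> space \<nu> \<longrightarrow> norm (case p of (x, t) \<Rightarrow> \<psi> x * P Y x t) \<le> B * (1 / Y)"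
          by (intro AE_I2) auto
        show "AE p in lborel \<Otimes>\<^sub>M \<nu>. p \<notin> {a..b} \<times> space \<nu> \<longrightarrow> (case p of (x, t) \<Rightarrow> \<psi> x * P Y x t) = 0"
        proof (intro AE_I2 impI)
          fix p assume "p \<in> space (lborel \<Otimes>\<^sub>M \<nu>)" "p \<notin> {a..b} \<times> space \<nu>"
          then have "fst p \<notin> {a..b}" by (cases p) (auto simp: space_pair_measure)
          then show "(case p of (x, t) \<Rightarrow> \<psi> x * P Y x t) = 0" using sup by (cases p) auto
        qed
      qed measurable
    qed
    also have "\<dots> = (\<integral>t. (\<integral>s. \<psi> (t + Y * s) / (1 + s\<^sup>2) \<partial>lborel) \<partial>\<nu>)"
    proof (rule Bochner_Integration.integral_cong[OF refl])
      fix t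
      have YP: "Y * (\<psi> (t + Y * s) * P Y (t + Y * s) t) = \<psi> (t + Y * s) / (1 + s\<^sup>2)" for s
      proof -
        have "(t + Y * s - t)\<^sup>2 + Y\<^sup>2 = Y * Y * (1 + s\<^sup>2)" by (simp add: power2_eq_square algebra_simps)
        then have "Y * P Y (t + Y * s) t = 1 / (1 + s\<^sup>2)" using Y by (simp add: P_def)
        moreover have "Y * (\<psi> (t + Y * s) * P Y (t + Y * s) t) = \<psi> (t + Y * s) * (Y * P Y (t + Y * s) t)"
          by (rule mult.left_commute)
        ultimately show ?thesis by simp
      qed
      have "(\<integral>x. \<psi> x * P Y x t \<partial>lborel) = \<bar>Y\<bar> *\<^sub>R (\<integral>s. \<psi> (t + Y * s) * P Y (t + Y * s) t \<partial>lborel)"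
        using Y by (intro lborel_integral_real_affine) simp
      also have "\<dots> = Y * (\<integral>s. \<psi> (t + Y * s) * P Y (t + Y * s) t \<partial>lborel)" using Y by simp
      also have "\<dots> = (\<integral>s. Y * (\<psi> (t + Y * s) * P Y (t + Y * s) t) \<partial>lborel)"
        by (rule integral_mult_right_zero[symmetric])
      finally show "(\<integral>x. \<psi> x * P Y x t \<partial>lborel) = (\<integral>s. \<psi> (t + Y * s) / (1 + s\<^sup>2) \<partial>lborel)"
        by (simp only: YP)
    qed
    finally show ?thesis .
  qed
  have bd: "norm (\<psi> x / (1 + s\<^sup>2)) \<le> B * (1 / (1 + s\<^sup>2))" for x s
    using B[of x] by (auto simp: divide_right_mono)
  have iB: "integrable lborel (\<lambda>s. B * (1 / (1 + s\<^sup>2)))" 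
    by (rule integrable_mult_right[OF cauchy_density_integral(1)])
  have inner: "(\<lambda>n. \<integral>s. \<psi> (t + y n * s) / (1 + s\<^sup>2) \<partial>lborel) \<longlonglongrightarrow> pi * \<psi> t" for t
  proof -
    have "(\<lambda>n. \<integral>s. \<psi> (t + y n * s) / (1 + s\<^sup>2) \<partial>lborel) \<longlonglongrightarrow> (\<integral>s. \<psi> t / (1 + s\<^sup>2) \<partial>lborel)"
    proof (rule integral_dominated_convergence[OF _ _ iB])
      show "AE s in lborel. (\<lambda>n. \<psi> (t + y n * s) / (1 + s\<^sup>2)) \<longlonglongrightarrow> \<psi> t / (1 + s\<^sup>2)"
      proof (rule AE_I2)
        fix s
        have "(\<lambda>n. t + y n * s) \<longlonglongrightarrow> t + 0 * s" by (intro tendsto_intros y)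
        then have "(\<lambda>n. \<psi> (t + y n * s)) \<longlonglongrightarrow> \<psi> t"
          using \<psi> by (simp add: continuous_on_tendsto_compose[OF \<psi>])
        then show "(\<lambda>n. \<psi> (t + y n * s) / (1 + s\<^sup>2)) \<longlonglongrightarrow> \<psi> t / (1 + s\<^sup>2)"
          by (intro tendsto_divide tendsto_const) (auto simp: add_nonneg_eq_0_iff)
      qed
    qed (use bd in auto)
    also have "(\<integral>s. \<psi> t / (1 + s\<^sup>2) \<partial>lborel) = (\<integral>s. \<psi> t * (1 / (1 + s\<^sup>2)) \<partial>lborel)" by simp
    also have "\<dots> = pi * \<psi> t" by (subst integral_mult_right_zero) (simp only: cauchy_density_integral mult.commute)
    finally show ?thesis .
  qed
  have "(\<lambda>n. \<integral>t. (\<integral>s. \<psi> (t + y n * s) / (1 + s\<^sup>2) \<partial>lborel) \<partial>\<nu>) \<longlonglongrightarrow> (\<integral>t. pi * \<psi> t \<partial>\<nu>)"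
  proof (rule integral_dominated_convergence[where w = "\<lambda>_. B * pi"])
    show "AE t in \<nu>. norm (\<integral>s. \<psi> (t + y n * s) / (1 + s\<^sup>2) \<partial>lborel) \<le> B * pi" for n
    proof (rule AE_I2)
      fix t
      have "norm (\<integral>s. \<psi> (t + y n * s) / (1 + s\<^sup>2) \<partial>lborel) \<le> (\<integral>s. B * (1 / (1 + s\<^sup>2)) \<partial>lborel)"
      proof (rule Bochner_Integration.integral_norm_bound_integral)
        show "integrable lborel (\<lambda>s. \<psi> (t + y n * s) / (1 + s\<^sup>2))"
        proof (rule Bochner_Integration.integrable_bound[OF iB])
          show "AE s in lborel. norm (\<psi> (t + y n * s) / (1 + s\<^sup>2)) \<le> norm (B * (1 / (1 + s\<^sup>2)))"
          proof (rule AE_I2)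
            fix s
            show "norm (\<psi> (t + y n * s) / (1 + s\<^sup>2)) \<le> norm (B * (1 / (1 + s\<^sup>2)))"
              using bd[of "t + y n * s" s] abs_ge_self[of "B * (1 / (1 + s\<^sup>2))"] unfolding real_norm_def by linarith
          qed
        qed measurable
      qed (use iB bd in auto)
      also have "\<dots> = B * pi" by (subst integral_mult_right_zero) (simp only: cauchy_density_integral)
      finally show "norm (\<integral>s. \<psi> (t + y n * s) / (1 + s\<^sup>2) \<partial>lborel) \<le> B * pi" .
    qed
  qed (use inner in auto)
  then show ?thesis using step[OF y0] by simp
qed

text \<open>The functions \<open>y n / norm (Complex x (y n) - t)\<close> are at most 1 and tend to
  0 for \<open>t \<noteq> x\<close>. This controls the error made below when a factor of the
  transform is replaced by its boundary value.\<close>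

lemma cauchy_transform_atomless_limit:
  assumes "measure \<nu> {x} = 0"
  shows "(\<lambda>n. y n * norm (cauchy_transform \<nu> (Complex x (y n)))) \<longlonglongrightarrow> 0"
proof -
  note [measurable_cong] = sets\<nu>
  have le1: "y n / norm (Complex x (y n) - complex_of_real t) \<le> 1" for n t
    using norm_Complex_minus_real_ge[of "y n" x t] y0[of n] by (simp add: divide_le_eq_1)
  have "AE t in \<nu>. t \<noteq> x"
    using assms AE_not_in[of "{x}" \<nu>] by (auto simp: null_sets_def emeasure_eq_measure sets\<nu>)
  have lim: "(\<lambda>n. \<integral>t. y n / norm (Complex x (y n) - complex_of_real t) \<partial>\<nu>) \<longlonglongrightarrow> (\<integral>t. 0 \<partial>\<nu>)"
  proof (rule integral_dominated_convergence[where w = "\<lambda>_. 1"])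
    show "AE t in \<nu>. (\<lambda>n. y n / norm (Complex x (y n) - complex_of_real t)) \<longlonglongrightarrow> 0"
      using \<open>AE t in \<nu>. t \<noteq> x\<close>
    proof eventually_elim
      case (elim t)
      have "(\<lambda>n. y n / norm (x + \<i> * y n - complex_of_real t)) \<longlonglongrightarrow> 0 / norm (x + \<i> * complex_of_real 0 - complex_of_real t)"
        using elim by (intro tendsto_intros y) auto
      then show ?case by (simp add: Complex_eq)
    qed
    show "AE t in \<nu>. norm (y n / norm (Complex x (y n) - complex_of_real t)) \<le> 1" for n
      using le1 y0[of n] by (intro AE_I2) (simp add: less_imp_le)
  qed (auto simp: Complex_eq)
  have "norm (y n * norm (cauchy_transform \<nu> (Complex x (y n)))) \<le> (\<integral>t. y n / norm (Complex x (y n) - complex_of_real t) \<partial>\<nu>)" for n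
  proof -
    have "norm (cauchy_transform \<nu> (Complex x (y n))) \<le> (\<integral>t. norm (1 / (Complex x (y n) - complex_of_real t)) \<partial>\<nu>)"
      unfolding cauchy_transform_def by (rule integral_norm_bound)
    then have "y n * norm (cauchy_transform \<nu> (Complex x (y n))) \<le> y n * (\<integral>t. norm (1 / (Complex x (y n) - complex_of_real t)) \<partial>\<nu>)"
      using y0[of n] by (intro mult_left_mono) auto
    then show ?thesis using y0[of n] by (simp add: norm_divide abs_mult flip: integral_mult_right_zero)
  qed
  then show ?thesis
    by (intro Lim_null_comparison[OF always_eventually lim[simplified]] allI)
qed

lemma cauchy_transform_bound: "y n * norm (cauchy_transform \<nu> (Complex x (y n))) \<le> 1"
proof -
  have "norm (cauchy_transform \<nu> (Complex x (y n))) \<le> (\<integral>t. 1 / y n \<partial>\<nu>)"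
    unfolding cauchy_transform_def
    by (rule Bochner_Integration.integral_norm_bound_integral)
       (rule integrable_cauchy_kernel[OF y0] integrable_const norm_inverse_Complex_minus_real_le[OF y0])+
  then show ?thesis using y0[of n] by (simp add: prob_space field_simps)
qed

text \<open>Replacing the factor \<open>F\<close> by its real boundary value \<open>\<rho>\<close>
  reduces the claim to \<open>poisson_limit\<close> for the test function
  \<open>\<phi> * \<rho>\<close>. The error is at most \<open>C\<close> times \<open>y n\<close>
  times the norm of the transform: it is bounded, and it tends to 0 except at atoms of
  \<open>\<nu>\<close>.\<close>

lemma stieltjes_inversion:
  fixes \<phi> \<rho> :: "real \<Rightarrow> real" and F :: "complex \<Rightarrow> complex"
  assumes \<psi>: "continuous_on UNIV (\<lambda>x. \<phi> x * \<rho> x)" and \<phi>m: "\<phi> \<in> borel_measurable borel"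
    and \<phi>: "\<And>x. \<bar>\<phi> x\<bar> \<le> 1" and sup: "\<And>x. x \<notin> {a..b} \<Longrightarrow> \<phi> x = 0"
    and B: "\<And>x. x \<in> {a..b} \<Longrightarrow> \<bar>\<rho> x\<bar> \<le> B" "0 \<le> B"
    and F: "\<And>x n. x \<in> {a..b} \<Longrightarrow> norm (F (Complex x (y n)) - complex_of_real (\<rho> x)) \<le> C * y n" and "0 \<le> C"
    and Fm: "\<And>n. (\<lambda>x. F (Complex x (y n))) \<in> borel_measurable borel"
  shows "(\<lambda>n. \<integral>x. \<phi> x * (- Im (cauchy_transform \<nu> (Complex x (y n)) * F (Complex x (y n)))) \<partial>lborel)
      \<longlonglongrightarrow> pi * (\<integral>t. \<phi> t * \<rho> t \<partial>\<nu>)"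
proof -
  note [measurable] = \<phi>m Fm cauchy_transform_measurable
  have \<psi>m [measurable]: "(\<lambda>x. \<phi> x * \<rho> x) \<in> borel_measurable borel" using \<psi> by (rule borel_measurable_continuous_onI)
  have \<psi>B: "\<bar>\<phi> x * \<rho> x\<bar> \<le> B" for x
  proof (cases "x \<in> {a..b}")
    case True
    then have "\<bar>\<phi> x\<bar> * \<bar>\<rho> x\<bar> \<le> 1 * B" using \<phi> B by (intro mult_mono) auto
    then show ?thesis by (simp add: abs_mult)
  qed (use sup B in auto)
  define E where "E n x = \<phi> x * (- Im (cauchy_transform \<nu> (Complex x (y n)) * F (Complex x (y n))))
      - \<phi> x * \<rho> x * (- Im (cauchy_transform \<nu> (Complex x (y n))))" for n x
  have Em [measurable]: "E n \<in> borel_measurable borel" for n unfolding E_def by measurable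
  have Ebound: "\<bar>E n x\<bar> \<le> indicator {a..b} x * (C * (y n * norm (cauchy_transform \<nu> (Complex x (y n)))))" for n x
  proof (cases "x \<in> {a..b}")
    case True
    let ?G = "cauchy_transform \<nu> (Complex x (y n))" and ?F = "F (Complex x (y n))"
    have "E n x = - (\<phi> x * Im (?G * (?F - complex_of_real (\<rho> x))))"
      by (simp add: E_def algebra_simps)
    then have "\<bar>E n x\<bar> = \<bar>\<phi> x\<bar> * \<bar>Im (?G * (?F - complex_of_real (\<rho> x)))\<bar>" by (simp add: abs_mult)
    also have "\<dots> \<le> 1 * norm (?G * (?F - complex_of_real (\<rho> x)))"
      using \<phi> by (intro mult_mono abs_Im_le_cmod) auto
    also have "\<dots> \<le> norm ?G * (C * y n)"
      using F[OF True] by (auto simp: norm_mult intro!: mult_left_mono)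
    finally show ?thesis using True by (simp add: mult_ac)
  qed (use sup in \<open>auto simp: E_def\<close>)
  have Ebound': "norm (E n x) \<le> indicator {a..b} x * C" for n x
  proof -
    have "indicator {a..b} x * (C * (y n * norm (cauchy_transform \<nu> (Complex x (y n))))) \<le> indicator {a..b} x * (C * 1)"
      using \<open>0 \<le> C\<close> by (intro mult_left_mono cauchy_transform_bound) auto
    then show ?thesis using Ebound[of n x] by simp
  qed
  have iC: "integrable lborel (\<lambda>x. indicator {a..b} x * C)"
    by (intro integrable_mult_left integrable_real_indicator) (auto simp: emeasure_lborel_Icc_eq)
  have iE: "integrable lborel (E n)" for n
  proof (rule Bochner_Integration.integrable_bound[OF iC])
    show "AE x in lborel. norm (E n x) \<le> norm (indicator {a..b} x * C)"
      using Ebound'[of n] \<open>0 \<le> C\<close> by (intro AE_I2) (simp add: abs_mult)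
  qed measurable
  have E0: "(\<lambda>n. \<integral>x. E n x \<partial>lborel) \<longlonglongrightarrow> (\<integral>x. 0 \<partial>(lborel :: real measure))"
  proof (rule integral_dominated_convergence[OF _ _ iC])
    \<comment> \<open>A finite measure has only countably many atoms, and these form a Lebesgue null
      set.\<close>
    have "AE x in lborel. x \<notin> {x. measure \<nu> {x} \<noteq> 0}"
      by (rule AE_not_in[OF countable_imp_null_set_lborel[OF countable_support]])
    then show "AE x in lborel. (\<lambda>n. E n x) \<longlonglongrightarrow> 0"
    proof eventually_elim
      case (elim x)
      then have "(\<lambda>n. indicator {a..b} x * (C * (y n * norm (cauchy_transform \<nu> (Complex x (y n)))))) \<longlonglongrightarrow> indicator {a..b} x * (C * 0)"
        by (intro tendsto_intros cauchy_transform_atomless_limit) auto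
      then have "(\<lambda>n. indicator {a..b} x * (C * (y n * norm (cauchy_transform \<nu> (Complex x (y n)))))) \<longlonglongrightarrow> 0"
        by simp
      then show ?case
        by (rule Lim_null_comparison[OF always_eventually, rotated]) (use Ebound in auto)
    qed
  qed (use Ebound' in auto)
  have lim: "(\<lambda>n. \<integral>x. \<phi> x * \<rho> x * (- Im (cauchy_transform \<nu> (Complex x (y n)))) \<partial>lborel) \<longlonglongrightarrow> pi * (\<integral>t. \<phi> t * \<rho> t \<partial>\<nu>)"
    by (rule poisson_limit[OF \<psi> \<psi>B]) (use sup in auto)
  have i2: "integrable lborel (\<lambda>x. \<phi> x * \<rho> x * (- Im (cauchy_transform \<nu> (Complex x (y n)))))" for n
  proof (rule integrableI_bounded_set[where A = "{a..b}" and B = "B * (1 / y n)"])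
    show "AE x in lborel. x \<in> {a..b} \<longrightarrow> norm (\<phi> x * \<rho> x * (- Im (cauchy_transform \<nu> (Complex x (y n))))) \<le> B * (1 / y n)"
    proof (intro AE_I2 impI)
      fix x
      have "\<bar>Im (cauchy_transform \<nu> (Complex x (y n)))\<bar> \<le> norm (cauchy_transform \<nu> (Complex x (y n)))" by (rule abs_Im_le_cmod)
      also have "\<dots> \<le> 1 / y n" using cauchy_transform_bound[of n x] y0[of n] by (simp add: field_simps)
      finally have "\<bar>\<phi> x * \<rho> x\<bar> * \<bar>Im (cauchy_transform \<nu> (Complex x (y n)))\<bar> \<le> B * (1 / y n)"
        using \<psi>B[of x] B(2) by (intro mult_mono) auto
      then show "norm (\<phi> x * \<rho> x * (- Im (cauchy_transform \<nu> (Complex x (y n))))) \<le> B * (1 / y n)"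
        by (simp add: abs_mult)
    qed
  qed (use sup in \<open>auto simp: emeasure_lborel_Icc_eq\<close>)
  have "(\<integral>x. \<phi> x * (- Im (cauchy_transform \<nu> (Complex x (y n)) * F (Complex x (y n)))) \<partial>lborel)
     = (\<integral>x. E n x \<partial>lborel) + (\<integral>x. \<phi> x * \<rho> x * (- Im (cauchy_transform \<nu> (Complex x (y n)))) \<partial>lborel)" for n
    by (subst Bochner_Integration.integral_add[OF iE i2, symmetric]) (simp add: E_def)
  then show ?thesis using tendsto_add[OF E0 lim] by simp
qed

end

section \<open>Transition measures\<close>

lemma line_cauchy_shift: "line_cauchy (\<lambda>w. k (w + e)) z = line_cauchy k (z + complex_of_real e)"
  unfolding line_cauchy_def
  using lborel_integral_real_affine[of 1 "\<lambda>w. complex_of_real (k w) / (z + complex_of_real e - complex_of_real w)" e]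
  by (simp add: algebra_simps)

text \<open>\<open>(\<omega> w - \<bar>w\<bar>) / 2\<close> equals
  \<open>(\<omega> w + w) / 2\<close> for negative \<open>w\<close> and that function minus
  \<open>w\<close> for positive \<open>w\<close>; it vanishes outside \<open>[p, q]\<close>. The
  finitely many corners 0, \<open>p\<close>, \<open>q\<close> are discarded.\<close>

lemma diagram_density_AE_derivative:
  fixes \<omega> v :: "real \<Rightarrow> real"
  assumes v: "AE w in lborel. ((\<lambda>t. (\<omega> t + t) / 2) has_real_derivative v w) (at w)"
    and pq: "p \<le> 0" "0 \<le> q" "\<And>z. z \<le> p \<Longrightarrow> \<omega> z = \<bar>z\<bar>" "\<And>z. q \<le> z \<Longrightarrow> \<omega> z = \<bar>z\<bar>"
  shows "AE w in lborel. ((\<lambda>w. (\<omega> w - \<bar>w\<bar>) / 2) has_real_derivative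
           (indicator {p..q} w * v w - indicator {0..q} w)) (at w)"
proof -
  have "AE w in lborel. w \<notin> {0, p, q}"
    by (rule AE_not_in[OF countable_imp_null_set_lborel]) auto
  with v show ?thesis
  proof eventually_elim
    case (elim w)
    let ?\<sigma> = "\<lambda>w. (\<omega> w - \<bar>w\<bar>) / 2"
    note transform = has_field_derivative_transform_within_open[where g = ?\<sigma>]
    have zero: "((\<lambda>_. 0) has_real_derivative 0) (at w)" by simp
    consider "w < p" | "p < w" "w < 0" | "0 < w" "w < q" | "q < w" using elim by force
    then show ?case
    proof cases
      case 1
      have "(?\<sigma> has_real_derivative 0) (at w)"
        by (rule transform[OF zero, where S = "{..<p}"]) (use 1 pq in auto)
      then show ?thesis using 1 pq by simp
    next
      case 2
      have "(?\<sigma> has_real_derivative v w) (at w)"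
        by (rule transform[OF elim(1), where S = "{..<0}"]) (use 2 in auto)
      then show ?thesis using 2 pq by simp
    next
      case 3
      have "((\<lambda>t. (\<omega> t + t) / 2 - t) has_real_derivative v w - 1) (at w)"
        by (intro derivative_intros elim(1))
      then have "(?\<sigma> has_real_derivative v w - 1) (at w)"
        by (rule transform[where S = "{0<..}"]) (use 3 in \<open>auto simp: field_simps\<close>)
      then show ?thesis using 3 pq by simp
    next
      case 4
      have "(?\<sigma> has_real_derivative 0) (at w)"
        by (rule transform[OF zero, where S = "{q<..}"]) (use 4 pq in auto)
      then show ?thesis using 4 pq by simp
    qed
  qed
qed

text \<open>The indicator of \<open>[0, q]\<close> in the derivative contributes
  \<open>Ln z - Ln (z - q)\<close> to the Cauchy integral. Its exponential exchanges the factor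
  \<open>z\<close> of the definition for \<open>z - q\<close> and leaves a density with values in
  [0, 1].\<close>

lemma transition_measure_cauchy_transform:
  fixes \<omega> v :: "real \<Rightarrow> real"
  assumes vm: "v \<in> borel_measurable borel" and v01: "\<And>w. 0 \<le> v w" "\<And>w. v w \<le> 1"
    and v: "AE w in lborel. ((\<lambda>t. (\<omega> t + t) / 2) has_real_derivative v w) (at w)"
    and pq: "p \<le> 0" "0 \<le> q" "\<And>z. z \<le> p \<Longrightarrow> \<omega> z = \<bar>z\<bar>" "\<And>z. q \<le> z \<Longrightarrow> \<omega> z = \<bar>z\<bar>"
    and \<mu>: "is_transition_measure \<omega> \<mu>" and z: "0 < Im z"
  shows "(z - complex_of_real q) * cauchy_transform \<mu> z = exp (- line_cauchy (\<lambda>w. indicator {p..q} w * v w) z)"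
proof -
  note [measurable] = vm
  let ?k = "\<lambda>w. indicator {p..q} w * v w" and ?I = "indicator {0..q} :: real \<Rightarrow> real"
  define g where "g w = ?k w - ?I w" for w
  have "g \<in> borel_measurable lborel" unfolding g_def by measurable
  moreover have "AE w in lborel. ((\<lambda>w. (\<omega> w - \<bar>w\<bar>) / 2) has_real_derivative g w) (at w)"
    unfolding g_def by (rule diagram_density_AE_derivative[OF v pq])
  moreover have "Im z \<noteq> 0" using z by simp
  ultimately have main: "z * cauchy_transform \<mu> z = exp (- line_cauchy g z)"
    using \<mu> unfolding is_transition_measure_def line_cauchy_def by blast
  have ik: "integrable lborel ?k"
    by (rule integrableI_bounded_set[where A = "{p..q}" and B = 1])
       (use v01 in \<open>auto simp: emeasure_lborel_Icc_eq indicator_def\<close>)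
  have iI: "integrable lborel ?I"
    using pq by (intro integrable_real_indicator) (auto simp: emeasure_lborel_Icc_eq)
  have ig: "integrable lborel g" unfolding g_def using ik iI by (rule Bochner_Integration.integrable_diff)
  have nz: "z \<noteq> 0" "z - complex_of_real q \<noteq> 0" using z by (auto simp: complex_eq_iff)
  have "line_cauchy (\<lambda>w. g w + ?I w) z = line_cauchy g z + line_cauchy ?I z"
    using z by (intro line_cauchy_add ig iI) auto
  moreover have "line_cauchy ?I z = Ln z - Ln (z - complex_of_real q)"
    using line_cauchy_interval[OF pq(2) z] by simp
  ultimately have "- line_cauchy g z = - line_cauchy ?k z + Ln z - Ln (z - complex_of_real q)"
    by (simp add: g_def)
  then have "exp (- line_cauchy g z) = exp (- line_cauchy ?k z) * exp (Ln z) / exp (Ln (z - complex_of_real q))"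
    by (simp only: exp_add exp_diff)
  then have "exp (- line_cauchy g z) = exp (- line_cauchy ?k z) * z / (z - complex_of_real q)"
    by (simp only: exp_Ln[OF nz(1)] exp_Ln[OF nz(2)])
  then have "(z - complex_of_real q) * (z * cauchy_transform \<mu> z) = exp (- line_cauchy ?k z) * z"
    using main nz(2) by simp
  then have "z * ((z - complex_of_real q) * cauchy_transform \<mu> z) = z * exp (- line_cauchy ?k z)"
    by (simp only: mult_ac)
  then show ?thesis using nz(1) by simp
qed

text \<open>The Lipschitz condition makes both \<open>(\<omega> t + t) / 2\<close> and its
  complement to \<open>t\<close> increasing, the situation of
  \<open>mono_contraction_density\<close>.\<close>

lemma continual_diagram_density:
  assumes \<omega>: "continual_diagram \<omega>"
  obtains v :: "real \<Rightarrow> real" where "v \<in> borel_measurable borel" "\<And>x. 0 \<le> v x" "\<And>x. v x \<le> 1"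
    "AE x in lborel. ((\<lambda>t. (\<omega> t + t) / 2) has_real_derivative v x) (at x)"
    "\<And>a b. a \<le> b \<Longrightarrow> (v has_integral ((\<omega> b + b) / 2 - (\<omega> a + a) / 2)) {a..b}"
proof (rule mono_contraction_density[of "\<lambda>t. (\<omega> t + t) / 2"])
  have lip: "\<bar>\<omega> x - \<omega> y\<bar> \<le> \<bar>x - y\<bar>" for x y using continual_diagramD(2)[OF \<omega>] .
  show "mono (\<lambda>t. (\<omega> t + t) / 2)"
  proof (rule monoI)
    show "(\<omega> x + x) / 2 \<le> (\<omega> y + y) / 2" if "x \<le> y" for x y using lip[of x y] that by auto
  qed
  show "mono (\<lambda>t. t - (\<omega> t + t) / 2)"
  proof (rule monoI)
    show "x - (\<omega> x + x) / 2 \<le> y - (\<omega> y + y) / 2" if "x \<le> y" for x y using lip[of x y] that by (auto simp: field_simps)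
  qed
qed (rule that)

section \<open>Boundary values of exponentials of Cauchy integrals\<close>

lemma exp_line_cauchy_bounds:
  fixes k :: "real \<Rightarrow> real"
  assumes k: "integrable lborel k" and \<delta>: "0 < \<delta>"
    and z: "\<And>w. k w \<noteq> 0 \<Longrightarrow> \<delta> \<le> norm (z - complex_of_real w)"
    and z': "\<And>w. k w \<noteq> 0 \<Longrightarrow> \<delta> \<le> norm (z' - complex_of_real w)"
  defines "N \<equiv> \<integral>w. \<bar>k w\<bar> \<partial>lborel"
  shows "norm (exp (- line_cauchy k z)) \<le> exp (N / \<delta>)"
    "norm (exp (- line_cauchy k z') - exp (- line_cauchy k z)) \<le> exp (N / \<delta>) * (norm (z' - z) * (N / \<delta>\<^sup>2))"
proof -
  have b: "norm (- line_cauchy k z) \<le> N / \<delta>" "norm (- line_cauchy k z') \<le> N / \<delta>"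
    using norm_line_cauchy_le[OF k \<delta> z] norm_line_cauchy_le[OF k \<delta> z'] by (auto simp: N_def)
  have e: "norm (exp x) \<le> exp (N / \<delta>)" if "norm x \<le> N / \<delta>" for x :: complex
    using norm_exp[of x] that by (meson exp_le_cancel_iff order_trans)
  show "norm (exp (- line_cauchy k z)) \<le> exp (N / \<delta>)" using e b by blast
  have "norm (exp (- line_cauchy k z') - exp (- line_cauchy k z)) \<le> exp (N / \<delta>) * norm (- line_cauchy k z' - (- line_cauchy k z))"
    by (rule field_differentiable_bound[of "cball 0 (N / \<delta>)" exp exp])
       (use e b in \<open>auto intro!: derivative_eq_intros\<close>)
  also have "\<dots> \<le> exp (N / \<delta>) * (norm (z' - z) * (N / \<delta>\<^sup>2))"
    using line_cauchy_diff_bound[OF k \<delta> z z'] by (intro mult_left_mono) (auto simp: N_def norm_minus_commute)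
  finally show "norm (exp (- line_cauchy k z') - exp (- line_cauchy k z)) \<le> exp (N / \<delta>) * (norm (z' - z) * (N / \<delta>\<^sup>2))" .
qed

lemma exp_line_cauchy_of_real:
  "exp (- line_cauchy k (complex_of_real x)) = complex_of_real (exp (- (\<integral>w. k w / (x - w) \<partial>lborel)))"
proof -
  have "line_cauchy k (complex_of_real x) = (\<integral>w. complex_of_real (k w / (x - w)) \<partial>lborel)"
    unfolding line_cauchy_def by (intro Bochner_Integration.integral_cong) auto
  also have "\<dots> = complex_of_real (\<integral>w. k w / (x - w) \<partial>lborel)" by (rule integral_complex_of_real)
  finally show ?thesis by (metis exp_of_real of_real_minus)
qed

text \<open>On an interval at distance \<delta> from the set where \<open>k\<close> is nonzero, the
  factor \<open>exp (- line_cauchy k z)\<close> extends to the real line with a real value \<rho>,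
  at a Lipschitz rate. These are the hypotheses of \<open>stieltjes_inversion\<close>.\<close>

lemma stieltjes_inversion_exp:
  fixes \<phi> k :: "real \<Rightarrow> real" and y :: "nat \<Rightarrow> real"
  defines "\<rho> \<equiv> \<lambda>x. exp (- (\<integral>w. k w / (x - w) \<partial>lborel))"
  assumes \<nu>: "prob_space \<nu>" "sets \<nu> = sets borel" and y0: "\<And>n. 0 < y n" and y: "y \<longlonglongrightarrow> 0"
    and k: "integrable lborel k" and \<delta>: "0 < \<delta>"
    and sep: "\<And>x w. x \<in> {a..b} \<Longrightarrow> k w \<noteq> 0 \<Longrightarrow> \<delta> \<le> \<bar>x - w\<bar>"
    and \<phi>: "continuous_on UNIV \<phi>" "\<And>x. \<bar>\<phi> x\<bar> \<le> 1" "\<And>x. x \<notin> {a..b} \<Longrightarrow> \<phi> x = 0" and ab: "a \<le> b"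
  shows "(\<lambda>n. \<integral>x. \<phi> x * (- Im (cauchy_transform \<nu> (Complex x (y n)) * exp (- line_cauchy k (Complex x (y n))))) \<partial>lborel)
      \<longlonglongrightarrow> pi * (\<integral>t. \<phi> t * \<rho> t \<partial>\<nu>)" "integrable \<nu> (\<lambda>t. \<phi> t * \<rho> t)"
proof -
  define N where "N = (\<integral>w. \<bar>k w\<bar> \<partial>lborel)"
  have N0: "0 \<le> N" unfolding N_def by (intro Bochner_Integration.integral_nonneg) auto
  have km [measurable]: "k \<in> borel_measurable borel" using k by auto
  have \<phi>m [measurable]: "\<phi> \<in> borel_measurable borel" using \<phi>(1) by (rule borel_measurable_continuous_onI)
  \<comment> \<open>The function \<rho> is controlled only on \<open>[a, b]\<close>. Composing it
    with the retraction \<open>cl\<close> gives a function continuous on the whole line, and after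
    multiplication by \<open>\<phi>\<close>, which vanishes outside \<open>[a, b]\<close>, nothing
    has changed.\<close>
  define cl where "cl x = max a (min b x)" for x
  have cl: "cl x \<in> {a..b}" for x using ab by (auto simp: cl_def)
  have cleq: "cl x = x" if "x \<in> {a..b}" for x using that by (auto simp: cl_def)
  have sepC: "\<delta> \<le> norm (Complex x Y - complex_of_real w)" if "x \<in> {a..b}" "k w \<noteq> 0" for x Y w
    using sep[OF that] abs_Re_le_cmod[of "Complex x Y - complex_of_real w"] by simp
  have sepR: "\<delta> \<le> norm (complex_of_real x - complex_of_real w)" if "x \<in> {a..b}" "k w \<noteq> 0" for x w
    using sepC[OF that, of 0] by (simp add: complex_of_real_def)
  have \<rho>F: "complex_of_real (\<rho> x) = exp (- line_cauchy k (complex_of_real x))" for x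
    by (simp add: \<rho>_def exp_line_cauchy_of_real)
  have \<rho>B: "\<bar>\<rho> x\<bar> \<le> exp (N / \<delta>)" if "x \<in> {a..b}" for x
    using exp_line_cauchy_bounds(1)[OF k \<delta>, of "complex_of_real x" "complex_of_real x"] sepR[OF that] \<rho>F[of x]
    by (metis N_def norm_of_real)
  have "continuous_on {a..b} \<rho>"
  proof (rule lipschitz_on_continuous_on)
    show "(exp (N / \<delta>) * (N / \<delta>\<^sup>2))-lipschitz_on {a..b} \<rho>"
    proof (rule lipschitz_onI)
      fix s t assume st: "s \<in> {a..b}" "t \<in> {a..b}"
      have "dist (\<rho> s) (\<rho> t) = norm (complex_of_real (\<rho> s) - complex_of_real (\<rho> t))"
        by (simp add: dist_norm flip: of_real_diff)
      also have "\<dots> \<le> exp (N / \<delta>) * (norm (complex_of_real s - complex_of_real t) * (N / \<delta>\<^sup>2))"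
        unfolding \<rho>F N_def by (rule exp_line_cauchy_bounds(2)[OF k \<delta> sepR[OF st(2)] sepR[OF st(1)]])
      also have "\<dots> = exp (N / \<delta>) * (N / \<delta>\<^sup>2) * dist s t"
        by (simp add: dist_norm flip: of_real_diff)
      finally show "dist (\<rho> s) (\<rho> t) \<le> exp (N / \<delta>) * (N / \<delta>\<^sup>2) * dist s t" .
    qed (use N0 in auto)
  qed
  then have "continuous_on UNIV (\<lambda>x. \<rho> (cl x))"
    by (rule continuous_on_compose2) (use cl in \<open>auto simp: cl_def intro!: continuous_intros\<close>)
  then have cont: "continuous_on UNIV (\<lambda>x. \<phi> x * \<rho> (cl x))"
    by (intro continuous_intros \<phi>(1))
  have eq: "\<phi> x * \<rho> (cl x) = \<phi> x * \<rho> x" for x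
    using cleq[of x] \<phi>(3)[of x] by (cases "x \<in> {a..b}") auto
  show "(\<lambda>n. \<integral>x. \<phi> x * (- Im (cauchy_transform \<nu> (Complex x (y n)) * exp (- line_cauchy k (Complex x (y n))))) \<partial>lborel)
      \<longlonglongrightarrow> pi * (\<integral>t. \<phi> t * \<rho> t \<partial>\<nu>)"
  proof (rule stieltjes_inversion[OF \<nu> y0 y, where B = "exp (N / \<delta>)" and a = a and b = b])
    show "continuous_on UNIV (\<lambda>x. \<phi> x * \<rho> x)" using cont by (simp only: eq)
    show "norm (exp (- line_cauchy k (Complex x (y n))) - complex_of_real (\<rho> x)) \<le> exp (N / \<delta>) * (N / \<delta>\<^sup>2) * y n"
      if "x \<in> {a..b}" for x n
    proof -
      have "norm (exp (- line_cauchy k (Complex x (y n))) - complex_of_real (\<rho> x)) \<le>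
          exp (N / \<delta>) * (norm (Complex x (y n) - complex_of_real x) * (N / \<delta>\<^sup>2))"
        unfolding \<rho>F N_def by (rule exp_line_cauchy_bounds(2)[OF k \<delta> sepR[OF that] sepC[OF that]])
      moreover have "norm (Complex x (y n) - complex_of_real x) = y n"
        using y0[of n] by (simp add: cmod_def)
      ultimately show ?thesis by (simp add: mult_ac)
    qed
    show "(\<lambda>x. exp (- line_cauchy k (Complex x (y n)))) \<in> borel_measurable borel" for n
      unfolding line_cauchy_def Complex_eq by measurable
  qed (use \<phi> \<rho>B N0 in auto)
  interpret prob_space \<nu> by fact
  note [measurable_cong] = \<nu>(2)
  have "integrable \<nu> (\<lambda>x. \<phi> x * \<rho> (cl x))"
  proof (rule integrable_const_bound[where B = "1 * exp (N / \<delta>)"])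
    show "AE x in \<nu>. norm (\<phi> x * \<rho> (cl x)) \<le> 1 * exp (N / \<delta>)"
      unfolding norm_mult using \<phi>(2) \<rho>B cl by (intro AE_I2 mult_mono) auto
    show "(\<lambda>x. \<phi> x * \<rho> (cl x)) \<in> borel_measurable \<nu>"
      using borel_measurable_continuous_onI[OF cont] by measurable
  qed
  then show "integrable \<nu> (\<lambda>t. \<phi> t * \<rho> t)" by (simp only: eq)
qed

section \<open>Cutoff functions and the mass inequality\<close>

definition trapezoid :: "real \<Rightarrow> real \<Rightarrow> real \<Rightarrow> real \<Rightarrow> real" where
  "trapezoid m a b x = max 0 (min 1 (m * min (x - a) (b - x)))"

lemma trapezoid_bounds: "0 \<le> trapezoid m a b x" "trapezoid m a b x \<le> 1" "\<bar>trapezoid m a b x\<bar> \<le> 1"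
  by (auto simp: trapezoid_def)

lemma trapezoid_continuous: "continuous_on A (trapezoid m a b)"
  unfolding trapezoid_def by (intro continuous_intros)

lemma trapezoid_eq_0:
  assumes "0 \<le> m" "x \<notin> {a..b}"
  shows "trapezoid m a b x = 0"
proof -
  have "min (x - a) (b - x) \<le> 0" using assms by auto
  then have "m * min (x - a) (b - x) \<le> 0" using assms by (intro mult_nonneg_nonpos)
  then show ?thesis by (simp add: trapezoid_def)
qed

lemma trapezoid_eq_1:
  assumes "0 \<le> m" "1 \<le> m * (x - a)" "1 \<le> m * (b - x)"
  shows "trapezoid m a b x = 1"
  using assms by (auto simp: trapezoid_def min_def max_def)

lemma tendsto_integral_cutoff:
  fixes f :: "real \<Rightarrow> real" and \<phi> :: "nat \<Rightarrow> real \<Rightarrow> real"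
  assumes \<nu>: "prob_space \<nu>" "sets \<nu> = sets borel" and f: "f \<in> borel_measurable borel" "\<And>x. \<bar>f x\<bar> \<le> 1"
    and \<phi>: "\<And>n. continuous_on UNIV (\<phi> n)" "\<And>n x. \<bar>\<phi> n x\<bar> \<le> 1" "\<And>x. \<forall>\<^sub>F n in sequentially. \<phi> n x = indicator A x"
    and A: "A \<in> sets borel"
  shows "(\<lambda>n. \<integral>x. \<phi> n x * f x \<partial>\<nu>) \<longlonglongrightarrow> (\<integral>x. indicator A x * f x \<partial>\<nu>)"
    "integrable \<nu> (\<lambda>x. \<phi> n x * f x)"
proof -
  interpret prob_space \<nu> by fact
  note [measurable] = f(1) A
  note [measurable_cong] = \<nu>(2)
  have [measurable]: "\<phi> n \<in> borel_measurable borel" for n using \<phi>(1) by (rule borel_measurable_continuous_onI)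
  have le: "norm (\<phi> n x * f x) \<le> 1" for n x
    using mult_mono[OF \<phi>(2)[of n x] f(2)[of x]] by (simp add: abs_mult)
  show "integrable \<nu> (\<lambda>x. \<phi> n x * f x)"
    by (rule integrable_const_bound[where B = 1]) (use le in auto)
  show "(\<lambda>n. \<integral>x. \<phi> n x * f x \<partial>\<nu>) \<longlonglongrightarrow> (\<integral>x. indicator A x * f x \<partial>\<nu>)"
  proof (rule integral_dominated_convergence[where w = "\<lambda>_. 1"])
    show "AE x in \<nu>. (\<lambda>n. \<phi> n x * f x) \<longlonglongrightarrow> indicator A x * f x"
      using \<phi>(3) by (intro AE_I2 tendsto_mult tendsto_const tendsto_eventually)
  qed (use le in auto)
qed

context
  fixes M :: real and u :: "real \<Rightarrow> real"
  assumes M: "0 < M" and um: "u \<in> borel_measurable borel"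
    and u0: "\<And>w. 0 \<le> u w" and u1: "\<And>w. u w \<le> 1" and us: "\<And>w. M < \<bar>w\<bar> \<Longrightarrow> u w = 0"
begin

text \<open>The supports are disjoint because \<open>b1 < a2\<close>, so the two test functions add
  up to at most the indicator of \<open>[a1, b2]\<close>. The weight \<open>h\<close> is
  nonnegative, and its integral over \<open>[a1, b2]\<close> is at most pi.\<close>

lemma krein_test_function_bound:
  fixes \<phi>1 \<phi>2 :: "real \<Rightarrow> real"
  assumes \<phi>1: "continuous_on UNIV \<phi>1" "\<And>x. 0 \<le> \<phi>1 x" "\<And>x. \<phi>1 x \<le> 1" "\<And>x. x \<notin> {a1..b1} \<Longrightarrow> \<phi>1 x = 0"
    and \<phi>2: "continuous_on UNIV \<phi>2" "\<And>x. 0 \<le> \<phi>2 x" "\<And>x. \<phi>2 x \<le> 1" "\<And>x. x \<notin> {a2..b2} \<Longrightarrow> \<phi>2 x = 0"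
    and ord: "a1 \<le> b1" "b1 < a2" "a2 \<le> b2" and y: "0 < y"
  defines "h \<equiv> \<lambda>x. - Im (krein_transform M u (Complex x y))"
  shows "(\<integral>x. \<phi>1 x * h x \<partial>lborel) + (\<integral>x. \<phi>2 x * h x \<partial>lborel) \<le> pi"
proof -
  have hc: "continuous_on A h" for A
    unfolding h_def by (intro continuous_intros continuous_krein_transform_line[OF M um u0 u1 us] y)
  have h0: "0 \<le> h x" for x
    using krein_transform_Im_le_0[OF M um u0 u1 us, of "Complex x y"] y by (simp add: h_def)
  have i: "integrable lborel (\<lambda>x. \<phi> x * h x)"
    if "continuous_on UNIV \<phi>" "\<And>x. x \<notin> {a1..b2} \<Longrightarrow> \<phi> x = 0" for \<phi>
  proof -
    have "continuous_on {a1..b2} (\<lambda>x. \<phi> x * h x)"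
      by (intro continuous_intros hc continuous_on_subset[OF that(1)]) auto
    then have "integrable lborel (\<lambda>x. indicator {a1..b2} x *\<^sub>R (\<phi> x * h x))"
      by (intro borel_integrable_compact) auto
    moreover have "indicator {a1..b2} x *\<^sub>R (\<phi> x * h x) = \<phi> x * h x" for x
      using that(2)[of x] by (cases "x \<in> {a1..b2}") auto
    ultimately show ?thesis by (simp only:)
  qed
  have z1: "\<phi>1 x = 0" if "x \<notin> {a1..b2}" for x using that ord by (intro \<phi>1(4)) auto
  have z2: "\<phi>2 x = 0" if "x \<notin> {a1..b2}" for x using that ord by (intro \<phi>2(4)) auto
  have ih: "set_integrable lborel {a1..b2} h"
    unfolding set_integrable_def by (intro borel_integrable_compact hc) auto
  have "(\<integral>x. \<phi>1 x * h x \<partial>lborel) + (\<integral>x. \<phi>2 x * h x \<partial>lborel) = (\<integral>x. \<phi>1 x * h x + \<phi>2 x * h x \<partial>lborel)"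
    by (rule Bochner_Integration.integral_add[symmetric]) (intro i \<phi>1 \<phi>2 z1 z2; simp)+
  also have "\<dots> \<le> (\<integral>x. indicator {a1..b2} x *\<^sub>R h x \<partial>lborel)"
  proof (rule Bochner_Integration.integral_mono)
    show "integrable lborel (\<lambda>x. \<phi>1 x * h x + \<phi>2 x * h x)"
      by (intro Bochner_Integration.integrable_add i \<phi>1 \<phi>2 z1 z2)
    show "integrable lborel (\<lambda>x. indicator {a1..b2} x *\<^sub>R h x)" using ih by (simp add: set_integrable_def)
    fix x
    have "\<phi>1 x + \<phi>2 x \<le> indicator {a1..b2} x"
    proof (cases "x \<in> {a1..b1}")
      case True
      then have "\<phi>2 x = 0" using ord by (intro \<phi>2(4)) auto
      then show ?thesis using True \<phi>1(3)[of x] ord by auto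
    next
      case False
      then have "\<phi>1 x = 0" by (rule \<phi>1(4))
      then show ?thesis using \<phi>2(3)[of x] z2[of x] by (cases "x \<in> {a1..b2}") auto
    qed
    from mult_right_mono[OF this h0] show "\<phi>1 x * h x + \<phi>2 x * h x \<le> indicator {a1..b2} x *\<^sub>R h x"
      by (simp add: distrib_right)
  qed
  also have "\<dots> = integral {a1..b2} h"
    using set_borel_integral_eq_integral(2)[OF ih] by (simp add: set_lebesgue_integral_def)
  also have "\<dots> \<le> pi"
    unfolding h_def using ord y by (intro krein_transform_line_integral_le_pi[OF M um u0 u1 us]) auto
  finally show ?thesis .
qed

text \<open>One function with nonnegative density and total mass at most pi on each horizontal line
  is factored in two ways. The first factor is regular left of \<open>c\<close>, where
  \<open>k1\<close> vanishes, the second right of \<open>d\<close>, where \<open>k2\<close>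
  vanishes. Stieltjes inversion on each side reads off \<open>\<nu>1\<close> and
  \<open>\<nu>2\<close> with positive weights, which are then bounded below by \<open>r\<close> and
  1.\<close>

lemma krein_mass_bound:
  fixes \<nu>1 \<nu>2 :: "real measure" and k1 k2 r :: "real \<Rightarrow> real"
  assumes \<nu>1: "prob_space \<nu>1" "sets \<nu>1 = sets borel" and \<nu>2: "prob_space \<nu>2" "sets \<nu>2 = sets borel"
    and k1: "integrable lborel k1" "\<And>w. w < c \<Longrightarrow> k1 w = 0"
    and k2: "integrable lborel k2" "\<And>w. d < w \<Longrightarrow> k2 w = 0" and cd: "c \<le> d"
    and H1: "\<And>z. 0 < Im z \<Longrightarrow> krein_transform M u z = cauchy_transform \<nu>1 z * exp (- line_cauchy k1 z)"
    and H2: "\<And>z. 0 < Im z \<Longrightarrow> krein_transform M u z = cauchy_transform \<nu>2 z * exp (- line_cauchy k2 z)"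
    and r: "r \<in> borel_measurable borel" "\<And>x. \<bar>r x\<bar> \<le> 1" "\<And>x. x < c \<Longrightarrow> r x \<le> exp (- (\<integral>w. k1 w / (x - w) \<partial>lborel))"
    and s: "\<And>x. d < x \<Longrightarrow> 1 \<le> exp (- (\<integral>w. k2 w / (x - w) \<partial>lborel))"
  shows "(\<integral>x. indicator {..<c} x * r x \<partial>\<nu>1) + measure \<nu>2 {d<..} \<le> 1"
proof -
  \<comment> \<open>The supports stay \<open>1 / Suc m\<close> away from \<open>c\<close> and
    \<open>d\<close>, the separation needed for inversion, and move outwards with \<open>m\<close>.
    With slope \<open>(Suc m)^2\<close> every fixed point of the open half-line eventually has value
    1.\<close>
  define \<phi>1 where "\<phi>1 m = trapezoid (real (Suc m) ^ 2) (- real m - \<bar>c\<bar> - 2) (c - 1 / Suc m)" for m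
  define \<phi>2 where "\<phi>2 m = trapezoid (real (Suc m) ^ 2) (d + 1 / Suc m) (real m + \<bar>d\<bar> + 2)" for m
  define y where "y n = 1 / real (Suc n)" for n
  have y0: "0 < y n" for n by (simp add: y_def)
  have y: "y \<longlonglongrightarrow> 0" unfolding y_def by (rule LIMSEQ_Suc, rule lim_const_over_n)
  have b1: "1 / real (Suc m) \<le> 1" "0 < 1 / real (Suc m)" for m by auto
  have test: "(\<integral>x. \<phi>1 m x * r x \<partial>\<nu>1) + (\<integral>x. \<phi>2 m x * 1 \<partial>\<nu>2) \<le> 1" if i1: "integrable \<nu>1 (\<lambda>x. \<phi>1 m x * r x)"
    and i2: "integrable \<nu>2 (\<lambda>x. \<phi>2 m x * 1)" for m
  proof -
    let ?a1 = "- real m - \<bar>c\<bar> - 2" and ?b1 = "c - 1 / Suc m" and ?a2 = "d + 1 / Suc m" and ?b2 = "real m + \<bar>d\<bar> + 2"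
    have o: "?a1 \<le> ?b1" "?b1 < ?a2" "?a2 \<le> ?b2" using b1[of m] cd by linarith+
    define \<rho>1 where "\<rho>1 x = exp (- (\<integral>w. k1 w / (x - w) \<partial>lborel))" for x
    define \<rho>2 where "\<rho>2 x = exp (- (\<integral>w. k2 w / (x - w) \<partial>lborel))" for x
    have z1: "\<phi>1 m x = 0" if "x \<notin> {?a1..?b1}" for x
      unfolding \<phi>1_def by (rule trapezoid_eq_0[OF _ that]) auto
    have z2: "\<phi>2 m x = 0" if "x \<notin> {?a2..?b2}" for x
      unfolding \<phi>2_def by (rule trapezoid_eq_0[OF _ that]) auto
    have c1: "continuous_on UNIV (\<phi>1 m)" "\<And>x. \<bar>\<phi>1 m x\<bar> \<le> 1" "\<And>x. 0 \<le> \<phi>1 m x" "\<And>x. \<phi>1 m x \<le> 1"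
      unfolding \<phi>1_def by (rule trapezoid_continuous trapezoid_bounds)+
    have c2: "continuous_on UNIV (\<phi>2 m)" "\<And>x. \<bar>\<phi>2 m x\<bar> \<le> 1" "\<And>x. 0 \<le> \<phi>2 m x" "\<And>x. \<phi>2 m x \<le> 1"
      unfolding \<phi>2_def by (rule trapezoid_continuous trapezoid_bounds)+
    have sep1: "1 / real (Suc m) \<le> \<bar>x - w\<bar>" if "x \<in> {?a1..?b1}" "k1 w \<noteq> 0" for x w
    proof -
      have "c \<le> w" using k1(2)[of w] that by force
      then show ?thesis using that by auto
    qed
    have sep2: "1 / real (Suc m) \<le> \<bar>x - w\<bar>" if "x \<in> {?a2..?b2}" "k2 w \<noteq> 0" for x w
    proof -
      have "w \<le> d" using k2(2)[of w] that by force
      then show ?thesis using that by auto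
    qed
    have S1: "(\<lambda>n. \<integral>x. \<phi>1 m x * (- Im (cauchy_transform \<nu>1 (Complex x (y n)) * exp (- line_cauchy k1 (Complex x (y n))))) \<partial>lborel)
        \<longlonglongrightarrow> pi * (\<integral>t. \<phi>1 m t * \<rho>1 t \<partial>\<nu>1)" "integrable \<nu>1 (\<lambda>t. \<phi>1 m t * \<rho>1 t)"
      unfolding \<rho>1_def
      by (rule stieltjes_inversion_exp[where a = ?a1 and b = ?b1, OF \<nu>1 y0 y k1(1) b1(2)[of m] _ c1(1,2) _ o(1)];
          use sep1 z1 in blast)+
    have S2: "(\<lambda>n. \<integral>x. \<phi>2 m x * (- Im (cauchy_transform \<nu>2 (Complex x (y n)) * exp (- line_cauchy k2 (Complex x (y n))))) \<partial>lborel)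
        \<longlonglongrightarrow> pi * (\<integral>t. \<phi>2 m t * \<rho>2 t \<partial>\<nu>2)" "integrable \<nu>2 (\<lambda>t. \<phi>2 m t * \<rho>2 t)"
      unfolding \<rho>2_def
      by (rule stieltjes_inversion_exp[where a = ?a2 and b = ?b2, OF \<nu>2 y0 y k2(1) b1(2)[of m] _ c2(1,2) _ o(3)];
          use sep2 z2 in blast)+
    have "(\<integral>x. \<phi>1 m x * (- Im (cauchy_transform \<nu>1 (Complex x (y n)) * exp (- line_cauchy k1 (Complex x (y n))))) \<partial>lborel)
       + (\<integral>x. \<phi>2 m x * (- Im (cauchy_transform \<nu>2 (Complex x (y n)) * exp (- line_cauchy k2 (Complex x (y n))))) \<partial>lborel) \<le> pi" for n
    proof -
      have "0 < Im (Complex x (y n))" for x using y0 by simp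
      note H = H1[OF this] H2[OF this]
      have "(\<integral>x. \<phi>1 m x * (- Im (krein_transform M u (Complex x (y n)))) \<partial>lborel)
          + (\<integral>x. \<phi>2 m x * (- Im (krein_transform M u (Complex x (y n)))) \<partial>lborel) \<le> pi"
        by (rule krein_test_function_bound[where ?a1.0 = ?a1 and ?b1.0 = ?b1 and ?a2.0 = ?a2 and ?b2.0 = ?b2,
              OF c1(1,3,4) _ c2(1,3,4) _ o y0]) (use z1 z2 in blast)+
      then show ?thesis by (simp only: H(1)[symmetric] H(2)[symmetric])
    qed
    \<comment> \<open>The bound by pi holds at every height \<open>y n\<close>; letting the height
      tend to 0 keeps it, and the factor pi from inversion cancels.\<close>
    then have "pi * (\<integral>t. \<phi>1 m t * \<rho>1 t \<partial>\<nu>1) + pi * (\<integral>t. \<phi>2 m t * \<rho>2 t \<partial>\<nu>2) \<le> pi"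
      by (intro LIMSEQ_le_const2[OF tendsto_add[OF S1(1) S2(1)]]) blast
    then have "pi * ((\<integral>t. \<phi>1 m t * \<rho>1 t \<partial>\<nu>1) + (\<integral>t. \<phi>2 m t * \<rho>2 t \<partial>\<nu>2)) \<le> pi * 1"
      by (simp add: distrib_left)
    then have "(\<integral>t. \<phi>1 m t * \<rho>1 t \<partial>\<nu>1) + (\<integral>t. \<phi>2 m t * \<rho>2 t \<partial>\<nu>2) \<le> 1"
      using pi_gt_zero mult_le_cancel_left_pos by blast
    moreover have "(\<integral>x. \<phi>1 m x * r x \<partial>\<nu>1) \<le> (\<integral>t. \<phi>1 m t * \<rho>1 t \<partial>\<nu>1)"
    proof (rule Bochner_Integration.integral_mono[OF i1 S1(2)])
      show "\<phi>1 m x * r x \<le> \<phi>1 m x * \<rho>1 x" for x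
      proof (cases "x \<in> {?a1..?b1}")
        case True
        then have "x < c" using b1(2)[of m] unfolding atLeastAtMost_iff by linarith
        then show ?thesis using r(3) c1(3) by (auto simp: \<rho>1_def intro!: mult_left_mono)
      qed (simp add: z1)
    qed
    moreover have "(\<integral>x. \<phi>2 m x * 1 \<partial>\<nu>2) \<le> (\<integral>t. \<phi>2 m t * \<rho>2 t \<partial>\<nu>2)"
    proof (rule Bochner_Integration.integral_mono[OF i2 S2(2)])
      show "\<phi>2 m x * 1 \<le> \<phi>2 m x * \<rho>2 x" for x
      proof (cases "x \<in> {?a2..?b2}")
        case True
        then have "d < x" using b1(2)[of m] unfolding atLeastAtMost_iff by linarith
        then show ?thesis using s c2(3) unfolding \<rho>2_def by (intro mult_left_mono) auto
      qed (simp add: z2)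
    qed
    ultimately show ?thesis by linarith
  qed
  \<comment> \<open>The end points \<open>c\<close> and \<open>d\<close> themselves always get the
    value 0, so the limits are indicators of open half-lines.\<close>
  have e1: "\<forall>\<^sub>F m in sequentially. \<phi>1 m x = indicator {..<c} x" for x
  proof (cases "x < c")
    case True
    obtain N where N: "2 / (c - x) \<le> real N" "\<bar>x\<bar> \<le> real N" using real_arch_simple[of "max (2 / (c - x)) \<bar>x\<bar>"] by auto
    have "\<phi>1 m x = 1" if "N \<le> m" for m
      unfolding \<phi>1_def
    proof (rule trapezoid_eq_1)
      have m: "1 \<le> real (Suc m)" "2 / (c - x) \<le> real (Suc m)" "\<bar>x\<bar> \<le> real m" using that N by auto
      then have 1: "2 \<le> real (Suc m) * (c - x)" using True by (simp add: pos_divide_le_eq)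
      have "1 * 1 \<le> (real (Suc m))\<^sup>2 * (x - (- real m - \<bar>c\<bar> - 2))"
        using m by (intro mult_mono) auto
      then show "1 \<le> (real (Suc m))\<^sup>2 * (x - (- real m - \<bar>c\<bar> - 2))" by simp
      have "1 * 1 \<le> real (Suc m) * (real (Suc m) * (c - x) - 1)"
        using m 1 by (intro mult_mono) auto
      also have "\<dots> = (real (Suc m))\<^sup>2 * (c - 1 / real (Suc m) - x)"
        by (simp add: power2_eq_square field_simps del: of_nat_Suc)
      finally show "1 \<le> (real (Suc m))\<^sup>2 * (c - 1 / real (Suc m) - x)" by simp
    qed auto
    then show ?thesis using True by (auto simp: eventually_sequentially)
  next
    case False
    have "\<phi>1 m x = 0" for m unfolding \<phi>1_def
    proof (rule trapezoid_eq_0)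
      show "x \<notin> {- real m - \<bar>c\<bar> - 2..c - 1 / real (Suc m)}" using False b1(2)[of m] unfolding atLeastAtMost_iff by linarith
    qed simp
    then show ?thesis using False by simp
  qed
  have e2: "\<forall>\<^sub>F m in sequentially. \<phi>2 m x = indicator {d<..} x" for x
  proof (cases "d < x")
    case True
    obtain N where N: "2 / (x - d) \<le> real N" "\<bar>x\<bar> \<le> real N" using real_arch_simple[of "max (2 / (x - d)) \<bar>x\<bar>"] by auto
    have "\<phi>2 m x = 1" if "N \<le> m" for m
      unfolding \<phi>2_def
    proof (rule trapezoid_eq_1)
      have m: "1 \<le> real (Suc m)" "2 / (x - d) \<le> real (Suc m)" "\<bar>x\<bar> \<le> real m" using that N by auto
      then have 1: "2 \<le> real (Suc m) * (x - d)" using True by (simp add: pos_divide_le_eq)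
      have "1 * 1 \<le> (real (Suc m))\<^sup>2 * (real m + \<bar>d\<bar> + 2 - x)"
        using m by (intro mult_mono) auto
      then show "1 \<le> (real (Suc m))\<^sup>2 * (real m + \<bar>d\<bar> + 2 - x)" by simp
      have "1 * 1 \<le> real (Suc m) * (real (Suc m) * (x - d) - 1)"
        using m 1 by (intro mult_mono) auto
      also have "\<dots> = (real (Suc m))\<^sup>2 * (x - (d + 1 / real (Suc m)))"
        by (simp add: power2_eq_square field_simps del: of_nat_Suc)
      finally show "1 \<le> (real (Suc m))\<^sup>2 * (x - (d + 1 / real (Suc m)))" by simp
    qed auto
    then show ?thesis using True by (auto simp: eventually_sequentially)
  next
    case False
    have "\<phi>2 m x = 0" for m unfolding \<phi>2_def
    proof (rule trapezoid_eq_0)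
      show "x \<notin> {d + 1 / real (Suc m)..real m + \<bar>d\<bar> + 2}" using False b1(2)[of m] unfolding atLeastAtMost_iff by linarith
    qed simp
    then show ?thesis using False by simp
  qed
  have c1: "continuous_on UNIV (\<phi>1 m)" "\<bar>\<phi>1 m x\<bar> \<le> 1" for m x
    unfolding \<phi>1_def by (rule trapezoid_continuous trapezoid_bounds)+
  have c2: "continuous_on UNIV (\<phi>2 m)" "\<bar>\<phi>2 m x\<bar> \<le> 1" for m x
    unfolding \<phi>2_def by (rule trapezoid_continuous trapezoid_bounds)+
  have T1: "(\<lambda>m. \<integral>x. \<phi>1 m x * r x \<partial>\<nu>1) \<longlonglongrightarrow> (\<integral>x. indicator {..<c} x * r x \<partial>\<nu>1)"
    "integrable \<nu>1 (\<lambda>x. \<phi>1 m x * r x)" for m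
    by (rule tendsto_integral_cutoff[OF \<nu>1 r(1,2) c1 e1]; simp)+
  have T2: "(\<lambda>m. \<integral>x. \<phi>2 m x * 1 \<partial>\<nu>2) \<longlonglongrightarrow> (\<integral>x. indicator {d<..} x * 1 \<partial>\<nu>2)"
    "integrable \<nu>2 (\<lambda>x. \<phi>2 m x * 1)" for m
    by (rule tendsto_integral_cutoff[OF \<nu>2 _ _ c2 e2]; simp)+
  have "(\<integral>x. indicator {..<c} x * r x \<partial>\<nu>1) + (\<integral>x. indicator {d<..} x * 1 \<partial>\<nu>2) \<le> 1"
    by (rule LIMSEQ_le_const2[OF tendsto_add[OF T1(1) T2(1)]]) (use test[OF T1(2) T2(2)] in blast)
  moreover have "(\<integral>x. indicator {d<..} x * 1 \<partial>\<nu>2) = measure \<nu>2 {d<..}"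
    using \<nu>2 by simp
  ultimately show ?thesis by simp
qed

end

section \<open>Lower bounds for the regular factors by the second mean value theorem\<close>

lemma integral_mult_antimono_nonneg:
  fixes f p :: "real \<Rightarrow> real"
  assumes f: "f integrable_on {a..b}" and ab: "a \<le> b"
    and p: "\<And>x y. a \<le> x \<Longrightarrow> x \<le> y \<Longrightarrow> y \<le> b \<Longrightarrow> p y \<le> p x" "0 \<le> p b"
    and I: "\<And>t. t \<in> {a..b} \<Longrightarrow> 0 \<le> integral {a..t} f"
  shows "0 \<le> integral {a..b} (\<lambda>x. p x * f x)"
proof -
  obtain c where c: "c \<in> {a..b}"
    "integral {a..b} (\<lambda>x. - p x * f x) = - p a * integral {a..c} f + - p b * integral {c..b} f"
    using second_mean_value_theorem[OF f ab, where g = "\<lambda>x. - p x"] p(1) by auto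
  \<comment> \<open>The two terms of the mean value formula are regrouped as in Abel summation, so
    that only integrals starting at \<open>a\<close> occur, with the nonnegative coefficients
    \<open>p a - p b\<close> and \<open>p b\<close>.\<close>
  have "integral {c..b} f = integral {a..b} f - integral {a..c} f"
    using Henstock_Kurzweil_Integration.integral_combine[of a c b f] c f by auto
  with c(2) have "integral {a..b} (\<lambda>x. p x * f x) = (p a - p b) * integral {a..c} f + p b * integral {a..b} f"
    by (simp add: algebra_simps)
  moreover have "p b \<le> p a" using p(1)[of a b] ab by simp
  ultimately show ?thesis using I[of c] I[of b] c(1) ab p(2) by simp
qed

lemma integral_mult_mono_nonneg:
  fixes f p :: "real \<Rightarrow> real"
  assumes f: "f integrable_on {a..b}" and ab: "a \<le> b"
    and p: "\<And>x y. a \<le> x \<Longrightarrow> x \<le> y \<Longrightarrow> y \<le> b \<Longrightarrow> p x \<le> p y" "0 \<le> p a"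
    and I: "\<And>t. t \<in> {a..b} \<Longrightarrow> 0 \<le> integral {t..b} f"
  shows "0 \<le> integral {a..b} (\<lambda>x. p x * f x)"
proof -
  obtain c where c: "c \<in> {a..b}"
    "integral {a..b} (\<lambda>x. p x * f x) = p a * integral {a..c} f + p b * integral {c..b} f"
    using second_mean_value_theorem[OF f ab, where g = p] p(1) by auto
  have "integral {a..c} f = integral {a..b} f - integral {c..b} f"
    using Henstock_Kurzweil_Integration.integral_combine[of a c b f] c f by auto
  with c(2) have "integral {a..b} (\<lambda>x. p x * f x) = (p b - p a) * integral {c..b} f + p a * integral {a..b} f"
    by (simp add: algebra_simps)
  moreover have "p a \<le> p b" using p(1)[of a b] ab by simp
  ultimately show ?thesis using I[of c] I[of a] c(1) ab p(2) by simp
qed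

lemma lborel_integral_on_interval:
  fixes f :: "real \<Rightarrow> real"
  assumes "integrable lborel f" "\<And>w. w \<notin> {a..b} \<Longrightarrow> f w = 0"
  shows "(f has_integral (\<integral>w. f w \<partial>lborel)) {a..b}"
proof -
  have "(f has_integral (\<integral>w. f w \<partial>lborel)) UNIV" using has_integral_integral_lborel[OF assms(1)] .
  moreover have "f = (\<lambda>w. if w \<in> {a..b} then f w else 0)" using assms(2) by auto
  ultimately show ?thesis using has_integral_restrict_UNIV by metis
qed

lemma integrable_divide_separated:
  fixes k :: "real \<Rightarrow> real"
  assumes k: "integrable lborel k" and \<delta>: "0 < \<delta>" "\<And>w. k w \<noteq> 0 \<Longrightarrow> \<delta> \<le> \<bar>x - w\<bar>"
  shows "integrable lborel (\<lambda>w. k w / (x - w))"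
proof -
  have [measurable]: "k \<in> borel_measurable borel" using k by auto
  show ?thesis
  proof (rule Bochner_Integration.integrable_bound)
    show "integrable lborel (\<lambda>w. k w / \<delta>)" using k by simp
    have "norm (k w / (x - w)) \<le> norm (k w / \<delta>)" for w
    proof (cases "k w = 0")
      case False
      then show ?thesis using \<delta>(2)[OF False] \<delta>(1) unfolding norm_divide by (intro frac_le) auto
    qed simp
    then show "AE w in lborel. norm (k w / (x - w)) \<le> norm (k w / \<delta>)" by (rule AE_I2)
  qed measurable
qed

text \<open>Mass at most \<open>\<epsilon>\<close> with density at most \<open>1\<close> attracts \<open>x\<close> most when it fills \<open>[c, c + \<epsilon>]\<close>;
  this extremal configuration gives the factor on the left-hand side.\<close>
lemma exp_neg_integral_lower_bound:
  fixes k :: "real \<Rightarrow> real"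
  assumes k: "integrable lborel k" "\<And>w. w \<notin> {c..M} \<Longrightarrow> k w = 0" "\<And>w. - 1 \<le> k w"
    and I: "\<And>t. c + \<epsilon> \<le> t \<Longrightarrow> t \<le> M \<Longrightarrow> - \<epsilon> \<le> integral {c..t} k"
    and \<epsilon>: "0 < \<epsilon>" "c + \<epsilon> \<le> M" and x: "x < c"
  shows "(c - x) / (c + \<epsilon> - x) \<le> exp (- (\<integral>w. k w / (x - w) \<partial>lborel))"
proof -
  define p where "p w = 1 / (w - x)" for w
  \<comment> \<open>\<open>- g\<close> is the extremal configuration; \<open>k\<close> is compared
    with it by showing that \<open>k + g\<close> has nonnegative integrals from \<open>c\<close> on
    and then weighting with the positive decreasing function \<open>p\<close>.\<close>
  define g where "g w = (if w \<in> {c..c + \<epsilon>} then 1 else 0 :: real)" for w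
  have ik: "k integrable_on {c..M}" using lborel_integral_on_interval[OF k(1,2)] by blast
  have ik': "k integrable_on {c..t}" if "t \<le> M" for t
    using that by (intro integrable_subinterval_real[OF ik]) auto
  have gi: "(g has_integral \<epsilon>) {c..t}" if "c + \<epsilon> \<le> t" for t
    unfolding g_def using that \<epsilon> has_integral_const_real[of "1::real" c "c + \<epsilon>"]
    by (subst has_integral_restrict) auto
  have gi': "g integrable_on {c..t}" if "t \<le> M" for t
    by (rule integrable_subinterval_real[OF has_integral_integrable[OF gi[OF \<epsilon>(2)]]]) (use that in auto)
  have "0 \<le> integral {c..M} (\<lambda>w. p w * (k w + g w))"
  proof (rule integral_mult_antimono_nonneg)
    show "(\<lambda>w. k w + g w) integrable_on {c..M}" by (intro integrable_add ik gi') simp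
    show "p b \<le> p a" if "c \<le> a" "a \<le> b" for a b
      unfolding p_def using that x by (intro frac_le) auto
    show "0 \<le> p M" using x \<epsilon> by (simp add: p_def)
    \<comment> \<open>Up to \<open>c + \<epsilon>\<close> the sum is pointwise nonnegative because
      \<open>k \<ge> - 1\<close>; beyond it, \<open>g\<close> has contributed its full mass
      \<epsilon>, which offsets the bound \<open>I\<close>.\<close>
    show "0 \<le> integral {c..t} (\<lambda>w. k w + g w)" if "t \<in> {c..M}" for t
    proof (cases "t \<le> c + \<epsilon>")
      case True
      have "(\<lambda>w. k w + g w) integrable_on {c..t}" using that by (intro integrable_add ik' gi') auto
      then show ?thesis
      proof (rule Henstock_Kurzweil_Integration.integral_nonneg)
        show "0 \<le> k w + g w" if "w \<in> {c..t}" for w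
          using that True k(3)[of w] by (auto simp: g_def)
      qed
    next
      case False
      then have "integral {c..t} (\<lambda>w. k w + g w) = integral {c..t} k + \<epsilon>"
        using that gi[of t] by (subst Henstock_Kurzweil_Integration.integral_add) (auto intro!: ik' gi' simp: integral_unique)
      then show ?thesis using I[of t] False that by auto
    qed
  qed (use \<epsilon> in auto)
  moreover have pg: "((\<lambda>w. p w * g w) has_integral (ln (c + \<epsilon> - x) - ln (c - x))) {c..M}"
  proof -
    have "(p has_integral (ln (c + \<epsilon> - x) - ln (c - x))) {c..c + \<epsilon>}"
    proof (rule fundamental_theorem_of_calculus)
      fix w assume "w \<in> {c..c + \<epsilon>}"
      then have "((\<lambda>w. ln (w - x)) has_real_derivative p w) (at w within {c..c + \<epsilon>})"
        unfolding p_def using x by (auto intro!: derivative_eq_intros)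
      then show "((\<lambda>w. ln (w - x)) has_vector_derivative p w) (at w within {c..c + \<epsilon>})"
        by (simp add: has_real_derivative_iff_has_vector_derivative)
    qed (use \<epsilon> in auto)
    then have "((\<lambda>w. if w \<in> {c..c + \<epsilon>} then p w else 0) has_integral (ln (c + \<epsilon> - x) - ln (c - x))) {c..M}"
      using \<epsilon> by (subst has_integral_restrict) auto
    moreover have "(\<lambda>w. if w \<in> {c..c + \<epsilon>} then p w else 0) = (\<lambda>w. p w * g w)" by (auto simp: g_def)
    ultimately show ?thesis by simp
  qed
  moreover have pk: "((\<lambda>w. p w * k w) has_integral - (\<integral>w. k w / (x - w) \<partial>lborel)) {c..M}"
  proof -
    have sep: "c - x \<le> \<bar>x - w\<bar>" if "k w \<noteq> 0" for w
    proof -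
      have "w \<in> {c..M}" using k(2)[of w] that by blast
      then show ?thesis by auto
    qed
    have "((\<lambda>w. k w / (x - w)) has_integral (\<integral>w. k w / (x - w) \<partial>lborel)) {c..M}"
      using x sep by (intro lborel_integral_on_interval integrable_divide_separated[OF k(1), of "c - x"]) (auto simp: k(2))
    then have "((\<lambda>w. - (k w / (x - w))) has_integral - (\<integral>w. k w / (x - w) \<partial>lborel)) {c..M}"
      by (rule has_integral_neg)
    moreover have "- (k w / (x - w)) = p w * k w" for w
      by (simp add: p_def minus_divide_right)
    ultimately show ?thesis by simp
  qed
  ultimately have "0 \<le> - (\<integral>w. k w / (x - w) \<partial>lborel) + (ln (c + \<epsilon> - x) - ln (c - x))"
    using integral_unique[OF has_integral_add[OF pk pg]] by (simp only: distrib_left)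
  then have "ln ((c - x) / (c + \<epsilon> - x)) \<le> - (\<integral>w. k w / (x - w) \<partial>lborel)"
    using x \<epsilon> by (simp add: ln_div)
  moreover have "0 < (c - x) / (c + \<epsilon> - x)" using x \<epsilon> by simp
  ultimately show ?thesis by (metis exp_le_cancel_iff exp_ln)
qed

text \<open>Seen from \<open>x\<close> on the right, the kernel \<open>1 / (x - w)\<close> is
  positive and increasing on \<open>[a, d]\<close>, while \<open>- k\<close> has nonnegative
  integrals over all \<open>[t, d]\<close>; hence the integral of \<open>k w / (x - w)\<close> is at
  most 0.\<close>

lemma exp_neg_integral_ge_1:
  fixes k :: "real \<Rightarrow> real"
  assumes k: "integrable lborel k" "\<And>w. w \<notin> {a..d} \<Longrightarrow> k w = 0"
    and I: "\<And>t. t \<in> {a..d} \<Longrightarrow> integral {t..d} k \<le> 0" and ad: "a \<le> d" and x: "d < x"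
  shows "1 \<le> exp (- (\<integral>w. k w / (x - w) \<partial>lborel))"
proof -
  define p where "p w = 1 / (x - w)" for w
  have ik: "k integrable_on {a..d}" using lborel_integral_on_interval[OF k(1,2)] by blast
  have "0 \<le> integral {a..d} (\<lambda>w. p w * - k w)"
  proof (rule integral_mult_mono_nonneg)
    show "(\<lambda>w. - k w) integrable_on {a..d}" using ik by (rule integrable_neg)
    show "p v \<le> p w" if "v \<le> w" "w \<le> d" for v w
      unfolding p_def using that x by (intro frac_le) auto
    show "0 \<le> p a" using x ad by (simp add: p_def)
    show "0 \<le> integral {t..d} (\<lambda>w. - k w)" if "t \<in> {a..d}" for t using I[OF that] by simp
  qed fact
  moreover have "((\<lambda>w. k w / (x - w)) has_integral (\<integral>w. k w / (x - w) \<partial>lborel)) {a..d}"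
  proof -
    have sep: "x - d \<le> \<bar>x - w\<bar>" if "k w \<noteq> 0" for w
    proof -
      have "w \<in> {a..d}" using k(2)[of w] that by blast
      then show ?thesis by auto
    qed
    show ?thesis
      using x sep by (intro lborel_integral_on_interval integrable_divide_separated[OF k(1), of "x - d"]) (auto simp: k(2))
  qed
  from has_integral_neg[OF this]
  have "((\<lambda>w. p w * - k w) has_integral - (\<integral>w. k w / (x - w) \<partial>lborel)) {a..d}"
    by (simp add: p_def)
  note integral_unique[OF this]
  ultimately have "0 \<le> - (\<integral>w. k w / (x - w) \<partial>lborel)" by (simp only:)
  then show ?thesis by simp
qed

section \<open>The comparison of the two diagrams\<close>

lemma cauchy_transform_shift:
  assumes "sets \<mu> = sets borel"
  shows "cauchy_transform (distr \<mu> borel (\<lambda>x. x - e)) z = cauchy_transform \<mu> (z + complex_of_real e)"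
proof -
  note [measurable_cong] = assms
  show ?thesis unfolding cauchy_transform_def
    by (subst integral_distr) (auto simp: algebra_simps)
qed

theorem theorem6p2:
  fixes \<Omega> \<omega> :: "real \<Rightarrow> real" and \<epsilon> z0 zmin :: real
    and \<mu>\<Omega> \<mu>\<omega> :: "real measure"
  assumes "continual_diagram \<Omega>"
    and "\<epsilon> > 0"
    and "\<Omega> (zmin + \<epsilon>) - \<Omega> (z0 + \<epsilon>) = z0 - zmin - 2 * \<epsilon>"
    and "\<forall>z. \<Omega> (z + \<epsilon>) - \<Omega> (z0 + \<epsilon>) = z0 - z - 2 * \<epsilon> \<longrightarrow> zmin \<le> z"
    and "is_transition_measure \<Omega> \<mu>\<Omega>"
    and "continual_diagram \<omega>"
    and "is_transition_measure \<omega> \<mu>\<omega>"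
    and "diagram_dist \<Omega> \<omega> \<le> \<epsilon>"
  shows "K_fun \<mu>\<omega> z0 \<ge>
           (\<integral>z \<in> {..zmin + \<epsilon>}. (1 - \<epsilon> / (zmin + 2 * \<epsilon> - z)) \<partial>\<mu>\<Omega>)"
proof -
  note \<Omega> = assms(1) and \<epsilon> = assms(2) and zmin = assms(3) and \<mu>\<Omega> = assms(5) and \<omega> = assms(6) and \<mu>\<omega> = assms(7)
  have dist: "\<bar>\<omega> z - \<Omega> (z + \<epsilon>)\<bar> \<le> \<epsilon>" for z
    by (rule diagram_dist_shift_bound[OF \<Omega> \<omega> assms(8)])
  have lip: "\<bar>\<Omega> s - \<Omega> t\<bar> \<le> \<bar>s - t\<bar>" for s t using continual_diagramD(2)[OF \<Omega>] .
  \<comment> \<open>Primitives of the densities \<open>a\<close> and \<open>b\<close>. The additive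
    constant in \<open>G\<close> is chosen so that the distance bound becomes the symmetric estimate
    of \<open>F - G\<close> by \<open>\<epsilon> / 2\<close>.\<close>
  define F where "F t = (\<omega> t + t) / 2" for t
  define G where "G t = (\<Omega> (t + \<epsilon>) + t) / 2" for t
  have FG: "F t - G t \<le> \<epsilon> / 2" "- \<epsilon> / 2 \<le> F t - G t" for t
    using dist[of t] by (auto simp: F_def G_def abs_le_iff field_simps)
  have Gmono: "G s \<le> G t" if "s \<le> t" for s t
    using lip[of "s + \<epsilon>" "t + \<epsilon>"] that by (auto simp: G_def)
  \<comment> \<open>The equation defining \<open>zmin\<close> says that \<open>G\<close> rises by
    exactly \<epsilon> from \<open>zmin\<close> to \<open>z0\<close>.\<close>
  have Gmin: "G z0 - G zmin = \<epsilon>" using zmin by (simp add: G_def field_simps)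
  have zmin_le: "zmin \<le> z0" using Gmono[of z0 zmin] Gmin \<epsilon> by (cases "zmin \<le> z0") auto
  \<comment> \<open>The flat stretch of \<open>u\<close> starts where the raised primitive
    \<open>G + \<epsilon> / 2\<close> reaches the level \<open>F z0\<close>. Such a point exists
    because \<open>F z0 - \<epsilon> / 2\<close> lies between \<open>G z0 - \<epsilon>\<close>,
    which is \<open>G zmin\<close>, and \<open>G z0\<close>.\<close>
  obtain zc where zc: "zmin \<le> zc" "zc \<le> z0" "G z0 - G zc = G z0 - F z0 + \<epsilon> / 2"
  proof -
    have "\<exists>x\<ge>zmin. x \<le> z0 \<and> G x = F z0 - \<epsilon> / 2"
    proof (rule IVT')
      show "G zmin \<le> F z0 - \<epsilon> / 2" "F z0 - \<epsilon> / 2 \<le> G z0"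
        using FG[of z0] Gmin by auto
      have "continuous_on {zmin..z0} (\<Omega> \<circ> (\<lambda>t. t + \<epsilon>))"
        by (intro continuous_on_compose continuous_intros continual_diagram_continuous_on[OF \<Omega>])
      then show "continuous_on {zmin..z0} G" unfolding G_def
        by (intro continuous_intros) (simp_all add: o_def)
    qed (rule zmin_le)
    then show ?thesis using that by force
  qed

  obtain C1 C2 where C: "\<And>z. C1 \<le> \<bar>z\<bar> \<Longrightarrow> \<Omega> z = \<bar>z\<bar>" "\<And>z. C2 \<le> \<bar>z\<bar> \<Longrightarrow> \<omega> z = \<bar>z\<bar>"
    using continual_diagramD(3)[OF \<Omega>] continual_diagramD(3)[OF \<omega>] by metis
  \<comment> \<open>\<open>M\<close> is large enough for both \<open>\<omega>\<close> and the
    shifted \<open>\<Omega>\<close> to coincide with their asymptotes outside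
    \<open>[-M, M]\<close>, and for the interval to contain \<open>zmin\<close> and
    \<open>z0 + \<epsilon>\<close>.\<close>
  define M where "M = \<bar>C1\<bar> + \<bar>C2\<bar> + \<bar>z0\<bar> + \<bar>zmin\<bar> + 2 * \<epsilon> + 1"
  have M: "0 < M" "\<epsilon> < M" "- M \<le> zmin" "z0 + \<epsilon> \<le> M" "C1 + \<epsilon> \<le> M" "C2 \<le> M"
    using \<epsilon> by (auto simp: M_def)

  obtain a where am: "a \<in> borel_measurable borel" and a01: "\<And>w. 0 \<le> a w" "\<And>w. a w \<le> 1"
    and aD: "AE w in lborel. ((\<lambda>t. (\<omega> t + t) / 2) has_real_derivative a w) (at w)"
    and aI': "\<And>s t. s \<le> t \<Longrightarrow> (a has_integral ((\<omega> t + t) / 2 - (\<omega> s + s) / 2)) {s..t}"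
    by (rule continual_diagram_density[OF \<omega>]) (rule that)
  have aI: "(a has_integral F t - F s) {s..t}" if "s \<le> t" for s t
    using aI'[OF that] by (simp add: F_def)
  obtain b' where b'm: "b' \<in> borel_measurable borel" and b'01: "\<And>w. 0 \<le> b' w" "\<And>w. b' w \<le> 1"
    and b'D: "AE w in lborel. ((\<lambda>t. (\<Omega> t + t) / 2) has_real_derivative b' w) (at w)"
    and b'I: "\<And>s t. s \<le> t \<Longrightarrow> (b' has_integral ((\<Omega> t + t) / 2 - (\<Omega> s + s) / 2)) {s..t}"
    by (rule continual_diagram_density[OF \<Omega>]) (rule that)
  define b where "b = (\<lambda>w. b' (w + \<epsilon>))"
  have bm: "b \<in> borel_measurable borel" unfolding b_def using b'm by measurable
  have b01: "0 \<le> b w" "b w \<le> 1" for w using b'01 by (auto simp: b_def)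
  have bI: "(b has_integral G t - G s) {s..t}" if "s \<le> t" for s t
  proof -
    have "(b' has_integral (\<Omega> (t + \<epsilon>) + (t + \<epsilon>)) / 2 - (\<Omega> (s + \<epsilon>) + (s + \<epsilon>)) / 2) {s + \<epsilon>..t + \<epsilon>}"
      using that by (intro b'I) simp
    from has_integral_shift_real_ivl[OF this, of \<epsilon>] show ?thesis
      by (simp add: b_def G_def field_simps)
  qed

  define u where "u w = (if \<bar>w\<bar> \<le> M then if w < zc then b w else if w \<le> z0 then 0 else a w else 0)" for w
  define \<nu> where "\<nu> = distr \<mu>\<Omega> borel (\<lambda>x. x - \<epsilon>)"
  \<comment> \<open>\<open>k1\<close> vanishes on the left of \<open>zc\<close> and
    \<open>k2\<close> on the right of \<open>z0\<close>; the exponentials of minus their Cauchy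
    integrals are the factors R and S.\<close>
  define k1 where "k1 w = u w - indicator {-M..M} w * b w" for w
  define k2 where "k2 w = u w - indicator {-M..M} w * a w" for w
  note [measurable] = am bm
  have um: "u \<in> borel_measurable borel" unfolding u_def by measurable
  note [measurable] = um
  have u01: "0 \<le> u w" "u w \<le> 1" and us: "M < \<bar>w\<bar> \<Longrightarrow> u w = 0" for w
    using a01[of w] b01[of w] by (auto simp: u_def)
  have i1: "integrable lborel (\<lambda>w. indicator {-M..M} w * a w)" "integrable lborel (\<lambda>w. indicator {-M..M} w * b w)"
    using a01 b01 by (auto intro!: integrable_bounded_support[where B = 1 and M = M] simp: indicator_def)
  have iu: "integrable lborel u"
    by (rule integrable_density[OF M(1) um u01 us])
  have ik: "integrable lborel k1" "integrable lborel k2"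
    unfolding k1_def k2_def using iu i1 by auto

  have p\<Omega>: "prob_space \<mu>\<Omega>" "sets \<mu>\<Omega> = sets borel" and p\<omega>: "prob_space \<mu>\<omega>" "sets \<mu>\<omega> = sets borel"
    using \<mu>\<Omega> \<mu>\<omega> by (auto simp: is_transition_measure_def)
  interpret P: prob_space \<mu>\<Omega> by (rule p\<Omega>)
  interpret Q: prob_space \<mu>\<omega> by (rule p\<omega>)
  have sh: "(\<lambda>x. x - \<epsilon>) \<in> \<mu>\<Omega> \<rightarrow>\<^sub>M borel" using p\<Omega>(2) by measurable
  have p\<nu>: "prob_space \<nu>" "sets \<nu> = sets borel"
    unfolding \<nu>_def by (rule P.prob_space_distr[OF sh]) simp

  have nz: "z - complex_of_real M \<noteq> 0" if "0 < Im z" for z using that by (auto simp: complex_eq_iff)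
  have H2: "krein_transform M u z = cauchy_transform \<mu>\<omega> z * exp (- line_cauchy k2 z)" if z: "0 < Im z" for z
  proof -
    have "(z - complex_of_real M) * cauchy_transform \<mu>\<omega> z = exp (- line_cauchy (\<lambda>w. indicator {-M..M} w * a w) z)"
      using M C(2) z by (intro transition_measure_cauchy_transform[OF am a01 aD _ _ _ _ \<mu>\<omega>]) auto
    then have "cauchy_transform \<mu>\<omega> z = exp (- line_cauchy (\<lambda>w. indicator {-M..M} w * a w) z) / (z - complex_of_real M)"
      using nz[OF z] by (simp add: eq_divide_eq mult.commute)
    moreover have "line_cauchy u z = line_cauchy (\<lambda>w. indicator {-M..M} w * a w) z + line_cauchy k2 z"
      using line_cauchy_add[OF i1(1) ik(2), of z] z by (simp add: k2_def)
    ultimately show ?thesis by (simp add: krein_transform_def exp_diff exp_minus divide_inverse)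
  qed
  have H1: "krein_transform M u z = cauchy_transform \<nu> z * exp (- line_cauchy k1 z)" if z: "0 < Im z" for z
  proof -
    \<comment> \<open>The representation of \<Omega> is taken on
      \<open>[-M + \<epsilon>, M + \<epsilon>]\<close>, which the shift by \<epsilon> carries to
      \<open>[-M, M]\<close>, the interval used for \<open>\<omega>\<close>.\<close>
    have "(z + complex_of_real \<epsilon> - complex_of_real (M + \<epsilon>)) * cauchy_transform \<mu>\<Omega> (z + complex_of_real \<epsilon>)
       = exp (- line_cauchy (\<lambda>w. indicator {-M+\<epsilon>..M+\<epsilon>} w * b' w) (z + complex_of_real \<epsilon>))"
      using M C(1) z \<epsilon> by (intro transition_measure_cauchy_transform[OF b'm b'01 b'D _ _ _ _ \<mu>\<Omega>]) auto
    moreover have "(\<lambda>w. indicator {-M+\<epsilon>..M+\<epsilon>} (w + \<epsilon>) * b' (w + \<epsilon>)) = (\<lambda>w. indicator {-M..M} w * b w)"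
      by (auto simp: b_def indicator_def)
    moreover have "cauchy_transform \<mu>\<Omega> (z + complex_of_real \<epsilon>) = cauchy_transform \<nu> z"
      unfolding \<nu>_def by (rule cauchy_transform_shift[OF p\<Omega>(2), symmetric])
    ultimately have "(z - complex_of_real M) * cauchy_transform \<nu> z = exp (- line_cauchy (\<lambda>w. indicator {-M..M} w * b w) z)"
      by (simp flip: line_cauchy_shift)
    then have "cauchy_transform \<nu> z = exp (- line_cauchy (\<lambda>w. indicator {-M..M} w * b w) z) / (z - complex_of_real M)"
      using nz[OF z] by (simp add: eq_divide_eq mult.commute)
    moreover have "line_cauchy u z = line_cauchy (\<lambda>w. indicator {-M..M} w * b w) z + line_cauchy k1 z"
      using line_cauchy_add[OF i1(2) ik(1), of z] z by (simp add: k1_def)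
    ultimately show ?thesis by (simp add: krein_transform_def exp_diff exp_minus divide_inverse)
  qed

  \<comment> \<open>The natural bound \<open>(zc - x) / (zc + \<epsilon> - x)\<close> increases with
    \<open>zc\<close>, which depends on \<open>\<omega>\<close>; it is weakened to
    \<open>zmin\<close> and to 0 between \<open>zmin\<close> and \<open>zc\<close>.\<close>
  define r where "r x = (if x < zmin then (zmin - x) / (zmin + \<epsilon> - x) else 0)" for x
  have rm: "r \<in> borel_measurable borel" unfolding r_def by measurable
  have r1: "\<bar>r x\<bar> \<le> 1" for x using \<epsilon> by (auto simp: r_def)
  have r_le: "r x \<le> exp (- (\<integral>w. k1 w / (x - w) \<partial>lborel))" if "x < zc" for x
  proof -
    have "(zc - x) / (zc + \<epsilon> - x) \<le> exp (- (\<integral>w. k1 w / (x - w) \<partial>lborel))"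
    proof (rule exp_neg_integral_lower_bound[OF ik(1)])
      show "k1 w = 0" if "w \<notin> {zc..M}" for w using that by (auto simp: k1_def u_def indicator_def)
      show "- 1 \<le> k1 w" for w using u01[of w] b01[of w] by (auto simp: k1_def indicator_def)
      show "zc + \<epsilon> \<le> M" using zc M by simp
      have eq1: "k1 w = - b w" if "w \<in> {zc..z0}" for w
        using that M zc \<epsilon> by (auto simp: k1_def u_def indicator_def)
      have eq2: "k1 w = a w - b w" if "w \<in> {z0..M} - {z0}" for w
        using that M zc \<epsilon> by (auto simp: k1_def u_def indicator_def)
      have I1: "(k1 has_integral - (G t - G zc)) {zc..t}" if "zc \<le> t" "t \<le> z0" for t
        using eq1 that by (intro has_integral_eq[OF _ has_integral_neg[OF bI[OF that(1)]]]) auto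
      \<comment> \<open>On the flat stretch the loss is at most \<open>G z0 - G zc\<close>, which
        equals \<open>G z0 - F z0 + \<epsilon> / 2\<close> and so is at most \<epsilon>.\<close>
      show "- \<epsilon> \<le> integral {zc..t} k1" if "zc + \<epsilon> \<le> t" "t \<le> M" for t
      proof (cases "t \<le> z0")
        case True
        then have "integral {zc..t} k1 = - (G t - G zc)"
          using that \<epsilon> by (intro integral_unique I1) auto
        then show ?thesis using Gmono[OF True] zc(3) FG[of z0] by simp
      next
        case False
        \<comment> \<open>Beyond \<open>z0\<close> the density of \<open>k1\<close> is
          \<open>a - b\<close>, except possibly at \<open>z0\<close> itself. By the choice of
          \<open>zc\<close> the total over \<open>[zc, t]\<close> collapses to
          \<open>F t - G t - \<epsilon> / 2\<close>.\<close>
        have "(k1 has_integral (F t - F z0) - (G t - G z0)) {z0..t}"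
          using False that eq2
          by (intro has_integral_spike_finite[OF _ _ has_integral_diff[OF aI bI], of "{z0}"]) auto
        then have "(k1 has_integral - (G z0 - G zc) + ((F t - F z0) - (G t - G z0))) {zc..t}"
          using False zc by (intro has_integral_combine[OF _ _ I1]) auto
        then show ?thesis using zc(3) FG[of t] by (simp add: integral_unique)
      qed
    qed (use \<epsilon> that in auto)
    moreover have "r x \<le> (zc - x) / (zc + \<epsilon> - x)"
    proof (cases "x < zmin")
      case True
      then show ?thesis using zc(1) \<epsilon> by (simp add: r_def field_simps)
    qed (use that \<epsilon> in \<open>simp add: r_def\<close>)
    ultimately show ?thesis by simp
  qed
  have s_ge: "1 \<le> exp (- (\<integral>w. k2 w / (x - w) \<partial>lborel))" if "z0 < x" for x
  proof (rule exp_neg_integral_ge_1[OF ik(2) _ _ _ that])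
    show "- M \<le> z0" using M zmin_le by simp
    show "k2 w = 0" if "w \<notin> {- M..z0}" for w using that zc by (auto simp: k2_def u_def indicator_def)
    have eq1: "k2 w = - a w" if "w \<in> {zc..z0}" for w
      using that M zc \<epsilon> by (auto simp: k2_def u_def indicator_def)
    have eq2: "k2 w = b w - a w" if "w \<in> {-M..zc} - {zc}" for w
      using that M zc \<epsilon> by (auto simp: k2_def u_def indicator_def)
    have I1: "(k2 has_integral - (F z0 - F t)) {t..z0}" if "zc \<le> t" "t \<le> z0" for t
      using eq1 that by (intro has_integral_eq[OF _ has_integral_neg[OF aI[OF that(2)]]]) auto
    show "integral {t..z0} k2 \<le> 0" if "t \<in> {- M..z0}" for t
    proof (cases "zc \<le> t")
      case True
      have "integral {t..z0} k2 = - (F z0 - F t)" using True that by (intro integral_unique I1) auto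
      moreover have "0 \<le> F z0 - F t"
        using that a01 by (intro has_integral_nonneg[OF aI]) auto
      ultimately show ?thesis by simp
    next
      case False
      \<comment> \<open>Since \<open>G zc = F z0 - \<epsilon> / 2\<close>, the total over
        \<open>[t, z0]\<close> collapses to \<open>F t - G t - \<epsilon> / 2\<close>, which is at
        most 0: the diagram of \<open>u\<close> lies above that of \<open>\<omega>\<close> to the
        left of \<open>z0\<close>.\<close>
      have "(k2 has_integral (G zc - G t) - (F zc - F t)) {t..zc}"
        using False that eq2
        by (intro has_integral_spike_finite[OF _ _ has_integral_diff[OF bI aI], of "{zc}"]) auto
      then have "(k2 has_integral ((G zc - G t) - (F zc - F t)) + - (F z0 - F zc)) {t..z0}"
        using False zc by (intro has_integral_combine[OF _ _ _ I1]) auto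
      then show ?thesis using zc(3) FG[of t] by (simp add: integral_unique)
    qed
  qed

  have "(\<integral>x. indicator {..<zc} x * r x \<partial>\<nu>) + measure \<mu>\<omega> {z0<..} \<le> 1"
    by (rule krein_mass_bound[OF M(1) um u01 us p\<nu> p\<omega> ik(1) _ ik(2) _ zc(2) H1 H2 rm r1 r_le s_ge])
       (use zc in \<open>auto simp: k1_def k2_def u_def indicator_def\<close>)
  moreover have "(\<integral>x. indicator {..<zc} x * r x \<partial>\<nu>) = (\<integral>z \<in> {..zmin + \<epsilon>}. (1 - \<epsilon> / (zmin + 2 * \<epsilon> - z)) \<partial>\<mu>\<Omega>)"
  proof -
    have "(\<integral>x. indicator {..<zc} x * r x \<partial>\<nu>) = (\<integral>z. indicator {..<zc} (z - \<epsilon>) * r (z - \<epsilon>) \<partial>\<mu>\<Omega>)"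
      unfolding \<nu>_def using rm by (intro integral_distr[OF sh]) measurable
    also have "\<dots> = (\<integral>z. indicator {..zmin + \<epsilon>} z *\<^sub>R (1 - \<epsilon> / (zmin + 2 * \<epsilon> - z)) \<partial>\<mu>\<Omega>)"
    proof (rule Bochner_Integration.integral_cong[OF refl])
      fix z
      \<comment> \<open>At \<open>z = zmin + \<epsilon>\<close> the integrand of the claim is
        \<open>1 - \<epsilon> / \<epsilon> = 0\<close> and \<open>r zmin = 0\<close>, so the closed
        half-line of the claim matches the strict inequality in \<open>r\<close>.\<close>
      consider "z < zmin + \<epsilon>" | "z = zmin + \<epsilon>" | "zmin + \<epsilon> < z" by linarith
      then show "indicator {..<zc} (z - \<epsilon>) * r (z - \<epsilon>) = indicator {..zmin + \<epsilon>} z *\<^sub>R (1 - \<epsilon> / (zmin + 2 * \<epsilon> - z))"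
      proof cases
        case 1
        then have "indicator {..<zc} (z - \<epsilon>) = (1 :: real)" using zc(1) by simp
        moreover have "r (z - \<epsilon>) = 1 - \<epsilon> / (zmin + 2 * \<epsilon> - z)"
          using 1 \<epsilon> by (simp add: r_def field_simps)
        ultimately show ?thesis using 1 by simp
      qed (use \<epsilon> in \<open>auto simp: r_def\<close>)
    qed
    finally show ?thesis by (simp add: set_lebesgue_integral_def)
  qed
  moreover have "measure \<mu>\<omega> {z0<..} = 1 - K_fun \<mu>\<omega> z0"
  proof -
    have "space \<mu>\<omega> = UNIV" using sets_eq_imp_space_eq[OF p\<omega>(2)] by simp
    then have "{z0<..} = space \<mu>\<omega> - {..z0}" by auto
    then show ?thesis using Q.prob_compl[of "{..z0}"] p\<omega>(2) by (simp add: K_fun_def)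
  qed
  ultimately show ?thesis by simp
qed

end
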